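(* Let $X$ be a Banach space. Then $X^*$ has the $C$-Schur property for some $C\ge0$ if and only if $X$ has the direct quantitative Dunford–Pettis property and $X$ contains no subspace isomorphic to $\ell_1$.
   Context: For a bounded sequence $(x_k)$ in a Banach space $Z$: $\operatorname{ca}(x_k)=\inf_{n}\operatorname{diam}\{x_k:k\ge n\}$ and $\delta(x_k)=\sup_{z^*\in B_{Z^*}}\inf_{n}\operatorname{diam}\{z^*(x_k):k\ge n\}$. $Z$ has the $C$-Schur property if $\operatorname{ca}(x_k)\le C\delta(x_k)$ for every bounded sequence in $Z$. For a bounded sequence $(x_k^* )$ in $X^*$, $\operatorname{ca}_{\rho^*}(x_k^* )=\sup\{\inf_n\sup_{k,l\ge n}\sup_{x\in L}|(x_k^*-x_l^* )(x)| : L\subset B_{X}\text{ weakly compact}\}$. $X$ has the direct quantitative Dunford–Pettis property if there is $K>0$ such that $\operatorname{ca}_{\rho^*}(x_n^* )\le K\,\delta(x_n^* )$ for every bounded sequence $(x_n^* )$ in $X^*$. *)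

theory Defs
  imports "HOL-Analysis.Analysis"
begin

text \<open>Real Banach spaces are modelled by types of class banach; the dual of X is
  the type X \<Rightarrow>L real of bounded linear functionals with the operator norm.\<close>

definition ca :: "(nat \<Rightarrow> 'z::real_normed_vector) \<Rightarrow> real" where
  "ca x = (INF n. diameter (x ` {n..}))"

definition qdelta :: "(nat \<Rightarrow> 'z::real_normed_vector) \<Rightarrow> real" where
  "qdelta x = (SUP f\<in>{f::'z \<Rightarrow>\<^sub>L real. norm f \<le> 1}.
                 INF n. diameter ((\<lambda>k. blinfun_apply f (x k)) ` {n..}))"

definition C_Schur :: "real \<Rightarrow> 'z::real_normed_vector itself \<Rightarrow> bool" where
  "C_Schur C _ \<longleftrightarrow> (\<forall>x::nat \<Rightarrow> 'z. bounded (range x) \<longrightarrow> ca x \<le> C * qdelta x)"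

definition weak_top :: "'a::real_normed_vector topology" where
  "weak_top = topology_generated_by
     {{y. blinfun_apply f y \<in> U} | (f::'a \<Rightarrow>\<^sub>L real) U. open U}"

text \<open>Weakly compact subsets of the closed unit ball (nonempty ones suffice,
  as the empty set contributes 0 to a supremum of nonnegative quantities).\<close>
definition ca_rho :: "(nat \<Rightarrow> ('a::real_normed_vector \<Rightarrow>\<^sub>L real)) \<Rightarrow> real" where
  "ca_rho x = (SUP L\<in>{L. L \<noteq> {} \<and> L \<subseteq> cball 0 1 \<and> compactin weak_top L}.
      INF n. SUP kl\<in>{n..} \<times> {n..}.
        SUP y\<in>L. \<bar>blinfun_apply (x (fst kl) - x (snd kl)) y\<bar>)"

definition direct_qDP :: "'a::real_normed_vector itself \<Rightarrow> bool" where
  "direct_qDP _ \<longleftrightarrow> (\<exists>K>0. \<forall>x::nat \<Rightarrow> ('a \<Rightarrow>\<^sub>L real).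
      bounded (range x) \<longrightarrow> ca_rho x \<le> K * qdelta x)"

definition l1 :: "(nat \<Rightarrow> real) set" where
  "l1 = {a. summable (\<lambda>n. \<bar>a n\<bar>)}"

definition l1norm :: "(nat \<Rightarrow> real) \<Rightarrow> real" where
  "l1norm a = (\<Sum>n. \<bar>a n\<bar>)"

definition contains_l1 :: "'a::real_normed_vector itself \<Rightarrow> bool" where
  "contains_l1 _ \<longleftrightarrow> (\<exists>(T::(nat \<Rightarrow> real) \<Rightarrow> 'a) c C. c > 0 \<and>
      (\<forall>a\<in>l1. \<forall>b\<in>l1. \<forall>r s. T (\<lambda>n. r * a n + s * b n) = r *\<^sub>R T a + s *\<^sub>R T b) \<and>
      (\<forall>a\<in>l1. c * l1norm a \<le> norm (T a) \<and> norm (T a) \<le> C * l1norm a))"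

end

theory Submission
  imports Defs "HOL-Library.Diagonal_Subsequence"
begin

text \<open>
  Suppose first that \<open>X\<close> has the direct quantitative Dunford--Pettis property with constant \<open>K\<close> and
  contains no copy of \<open>\<ell>\<^sub>1\<close>. If \<open>ca (f\<^sub>n) > c\<close>, there are differences \<open>g\<^sub>n = f\<^sub>k - f\<^sub>l\<close> with
  arbitrarily large \<open>k, l\<close> and \<open>x\<^sub>n\<close> in the unit ball with \<open>g\<^sub>n(x\<^sub>n) > c\<close>. By Rosenthal's theorem
  \<open>(x\<^sub>n)\<close> may be taken weakly Cauchy, and since \<open>limsup \<bar>g\<^sub>n(x\<^sub>m)\<bar> \<le> \<delta>(f\<^sub>n)\<close> for each fixed \<open>m\<close>,
  halved differences of a sparse subsequence form a weakly null sequence in the unit ball on which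
  the \<open>g\<^sub>n\<close> exceed roughly \<open>(c - \<delta>)/2\<close>. Hence \<open>(c - \<delta>)/2 \<le> K \<delta>\<close>, so \<open>X\<^sup>*\<close> is
  \<open>(2K+1)\<close>-Schur. Rosenthal's theorem itself is proved by Rosenthal's combinatorial argument: a
  sequence of pairs of sets without a convergent subsequence has an independent subsequence.

  Conversely, \<open>ca\<^sub>\<rho> \<le> ca\<close>, so the Schur property gives the Dunford--Pettis property. If \<open>X\<close>
  contains a copy of \<open>\<ell>\<^sub>1\<close> with basis \<open>(e\<^sub>n)\<close>, extend the sign functionals \<open>e\<^sub>n \<mapsto> \<plusminus>1\<close>
  (\<open>n < N\<close>) to \<open>X\<close> by Hahn--Banach, average them against Rademacher functions, and pass to a Banach
  limit as \<open>N \<rightarrow> \<infinity>\<close>. The resulting functionals \<open>g\<^sub>n\<close> are biorthogonal to \<open>(e\<^sub>n)\<close> and satisfy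
  \<open>\<parallel>\<Sum> s\<^sub>n g\<^sub>n\<parallel> \<le> const \<cdot> \<parallel>s\<parallel>\<^sub>2\<close>; so they are weakly null, but not norm Cauchy.
\<close>

subsection \<open>The Hahn--Banach theorem and Banach limits\<close>

definition sublinear :: "('v::real_vector \<Rightarrow> real) \<Rightarrow> bool" where
  "sublinear p \<longleftrightarrow> (\<forall>x y. p (x + y) \<le> p x + p y) \<and> (\<forall>t x. 0 \<le> t \<longrightarrow> p (t *\<^sub>R x) = t * p x)"

text \<open>The reverse homogeneity inequality is \<open>scale\<close> for the factor
  \<open>inverse t\<close> at \<open>t *\<^sub>R x\<close>; the factors 2 and 1/2 at the origin
  force \<open>p 0 = 0\<close>.\<close>

lemma sublinearI:
  assumes add: "\<And>x y. p (x + y) \<le> p x + p y"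
    and scale: "\<And>t x. 0 < t \<Longrightarrow> p (t *\<^sub>R x) \<le> t * p x"
  shows "sublinear p"
proof -
  have "p 0 = 0"
    using scale[of 2 0] scale[of "1/2" 0] by simp
  moreover have "p (t *\<^sub>R x) = t * p x" if "0 < t" for t x
  proof (rule antisym)
    have "p x \<le> inverse t * p (t *\<^sub>R x)"
      using scale[of "inverse t" "t *\<^sub>R x"] that by simp
    then show "t * p x \<le> p (t *\<^sub>R x)"
      using that by (simp add: field_simps)
  qed (use scale that in blast)
  ultimately show ?thesis
    unfolding sublinear_def using add by (metis less_eq_real_def mult_zero_left scaleR_zero_left)
qed

lemma sublinear_add: "sublinear p \<Longrightarrow> p (x + y) \<le> p x + p y"
  and sublinear_scale: "sublinear p \<Longrightarrow> 0 \<le> t \<Longrightarrow> p (t *\<^sub>R x) = t * p x"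
  by (auto simp: sublinear_def)

lemma sublinear_zero: "sublinear p \<Longrightarrow> p 0 = 0"
  using sublinear_scale[of p 0 0] by simp

lemma sublinear_diff_ge: "sublinear p \<Longrightarrow> p y - p (- x) \<le> p (x + y)"
  using sublinear_add[of p "x + y" "- x"] by simp

text \<open>Shared by the three infima taken below: over a chain, over the ray \<open>{0..}\<close>
  and over a subspace. The bound \<open>b x\<close>, uniform in the index, keeps the infimum finite,
  and the witness \<open>k\<close> may depend on the points.\<close>

lemma sublinear_INF:
  assumes ne: "I \<noteq> {}"
    and lower: "\<And>i x. i \<in> I \<Longrightarrow> b x \<le> q i x"
    and add: "\<And>i j x y. i \<in> I \<Longrightarrow> j \<in> I \<Longrightarrow> \<exists>k\<in>I. q k (x + y) \<le> q i x + q j y"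
    and scale: "\<And>i t x. i \<in> I \<Longrightarrow> 0 < t \<Longrightarrow> \<exists>k\<in>I. q k (t *\<^sub>R x) \<le> t * q i x"
  shows "sublinear (\<lambda>x. INF i\<in>I. q i x :: real)"
proof (rule sublinearI)
  have bdd: "bdd_below ((\<lambda>i. q i x) ` I)" for x
    using lower by (auto intro!: bdd_belowI2[where m = "b x"])
  have le: "(INF i\<in>I. q i x) \<le> q i x" if "i \<in> I" for i x
    using bdd that by (rule cINF_lower)
  fix x y
  show "(INF i\<in>I. q i (x + y)) \<le> (INF i\<in>I. q i x) + (INF i\<in>I. q i y)"
  proof (rule field_le_epsilon)
    fix e :: real assume e: "0 < e"
    obtain i where i: "i \<in> I" "q i x < (INF i\<in>I. q i x) + e / 2"
      using cINF_less_iff[OF ne bdd, of x "(INF i\<in>I. q i x) + e / 2"] e by auto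
    obtain j where j: "j \<in> I" "q j y < (INF i\<in>I. q i y) + e / 2"
      using cINF_less_iff[OF ne bdd, of y "(INF i\<in>I. q i y) + e / 2"] e by auto
    obtain k where k: "k \<in> I" "q k (x + y) \<le> q i x + q j y"
      using add i(1) j(1) by blast
    show "(INF i\<in>I. q i (x + y)) \<le> (INF i\<in>I. q i x) + (INF i\<in>I. q i y) + e"
      using le[OF k(1), of "x + y"] i j k by simp
  qed
  fix t :: real assume t: "0 < t"
  have "(INF i\<in>I. q i (t *\<^sub>R x)) / t \<le> (INF i\<in>I. q i x)"
  proof (rule cINF_greatest[OF ne])
    fix i assume "i \<in> I"
    then obtain k where "k \<in> I" "q k (t *\<^sub>R x) \<le> t * q i x"
      using scale t by blast
    then show "(INF i\<in>I. q i (t *\<^sub>R x)) / t \<le> q i x"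
      using le[of k "t *\<^sub>R x"] t by (simp add: field_simps)
  qed
  then show "(INF i\<in>I. q i (t *\<^sub>R x)) \<le> t * (INF i\<in>I. q i x)"
    using t by (simp add: field_simps)
qed

text \<open>Zorn's lemma for the reversed pointwise order. The pointwise infimum of a chain is
  sublinear, and it is finite because every sublinear \<open>q \<le> p\<close> satisfies
  \<open>- p (- x) \<le> q x\<close>.\<close>

lemma ex_minimal_sublinear:
  fixes p :: "'v::real_vector \<Rightarrow> real"
  assumes p: "sublinear p"
  shows "\<exists>q. sublinear q \<and> q \<le> p \<and> (\<forall>r. sublinear r \<and> r \<le> q \<longrightarrow> r = q)"
proof -
  define A where "A = {q. sublinear q \<and> q \<le> p}"
  have "\<exists>m\<in>A. \<forall>a\<in>A. m \<ge> a \<longrightarrow> a = m"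
  proof (rule predicate_Zorn)
    show "partial_order_on A (relation_of (\<ge>) A)"
      by (rule partial_order_on_relation_ofI) auto
    fix C assume C: "C \<in> Chains (relation_of (\<ge>) A)"
    then have CA: "C \<subseteq> A" and chain: "\<And>a b. a \<in> C \<Longrightarrow> b \<in> C \<Longrightarrow> a \<le> b \<or> b \<le> a"
      by (auto simp: Chains_def relation_of_def)
    show "\<exists>u\<in>A. \<forall>a\<in>C. a \<ge> u"
    proof (cases "C = {}")
      case True
      then show ?thesis using p by (auto simp: A_def)
    next
      case False
      have sub: "sublinear q" "q \<le> p" if "q \<in> C" for q
        using that CA by (auto simp: A_def)
      have lower: "- p (- x) \<le> q x" if "q \<in> C" for q x
        using sublinear_diff_ge[OF sub(1)[OF that], of 0 x] sublinear_zero[OF sub(1)[OF that]]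
          le_funD[OF sub(2)[OF that], of "- x"] sublinear_add[OF sub(1)[OF that], of x "- x"] by simp
      define u where "u = (\<lambda>x. INF q\<in>C. q x)"
      have "sublinear u"
        unfolding u_def
      proof (rule sublinear_INF[OF False lower])
        fix i j :: "'v \<Rightarrow> real" and x y assume ij: "i \<in> C" "j \<in> C"
        then consider "i \<le> j" | "j \<le> i" using chain by blast
        then show "\<exists>k\<in>C. k (x + y) \<le> i x + j y"
        proof cases
          case 1
          then show ?thesis
            using ij sublinear_add[OF sub(1)[OF ij(1)], of x y] le_funD[OF 1, of y]
            by (intro bexI[of _ i]) auto
        next
          case 2
          then show ?thesis
            using ij sublinear_add[OF sub(1)[OF ij(2)], of x y] le_funD[OF 2, of x]
            by (intro bexI[of _ j]) auto
        qed
      next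
        fix i :: "'v \<Rightarrow> real" and t :: real and x assume "i \<in> C" "0 < t"
        then show "\<exists>k\<in>C. k (t *\<^sub>R x) \<le> t * i x"
          using sublinear_scale[OF sub(1), of i t x] by (intro bexI[of _ i]) auto
      qed
      moreover have le: "u \<le> q" if "q \<in> C" for q
        unfolding u_def using lower that
        by (intro le_funI cINF_lower bdd_belowI2[where m = "- p (- _)"]) auto
      moreover have "u \<le> p"
        using False le sub(2) by (meson ex_in_conv order_trans)
      ultimately show ?thesis by (auto simp: A_def)
    qed
  qed
  then show ?thesis
    unfolding A_def by (metis (mono_tags, lifting) mem_Collect_eq order_trans)
qed

lemma minimal_sublinear_linear:
  fixes q :: "'v::real_vector \<Rightarrow> real"
  assumes q: "sublinear q" and minimal: "\<And>r. sublinear r \<Longrightarrow> r \<le> q \<Longrightarrow> r = q"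
  shows "linear q"
proof -
  have super: "q x + q y \<le> q (x + y)" for x y
  proof -
    \<comment> \<open>Superadditivity: this sublinear minorant of \<open>q\<close> equals \<open>q\<close>; evaluate at \<open>t = 1\<close>.\<close>
    define r where "r = (\<lambda>x. INF t\<in>{0..}. q (x + t *\<^sub>R y) - t * q y)"
    \<comment> \<open>The bound does not depend on \<open>t\<close>, since
      \<open>q (t *\<^sub>R y) \<le> q (x + t *\<^sub>R y) + q (- x)\<close>.\<close>
    have lower: "- q (- x) \<le> q (x + t *\<^sub>R y) - t * q y" if "t \<in> {0..}" for t x
      using sublinear_diff_ge[OF q, of "t *\<^sub>R y" x] sublinear_scale[OF q, of t y] that by simp
    have le: "r x \<le> q (x + t *\<^sub>R y) - t * q y" if "t \<ge> 0" for t x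
      unfolding r_def using lower that
      by (intro cINF_lower bdd_belowI2[where m = "- q (- x)"]) auto
    have "sublinear r"
      unfolding r_def
    proof (rule sublinear_INF[OF _ lower])
      fix s t :: real and x z assume "s \<in> {0..}" "t \<in> {0..}"
      then show "\<exists>k\<in>{0..}. q (x + z + k *\<^sub>R y) - k * q y
          \<le> q (x + s *\<^sub>R y) - s * q y + (q (z + t *\<^sub>R y) - t * q y)"
        using sublinear_add[OF q, of "x + s *\<^sub>R y" "z + t *\<^sub>R y"]
        by (intro bexI[of _ "s + t"]) (auto simp: algebra_simps)
    next
      fix s t :: real and x assume "s \<in> {0..}" "0 < t"
      then show "\<exists>k\<in>{0..}. q (t *\<^sub>R x + k *\<^sub>R y) - k * q y \<le> t * (q (x + s *\<^sub>R y) - s * q y)"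
        using sublinear_scale[OF q, of t "x + s *\<^sub>R y"]
        by (intro bexI[of _ "t * s"]) (auto simp: algebra_simps)
    qed auto
    moreover have "r \<le> q"
      using le[of 0] by (auto simp: le_fun_def)
    ultimately have "r = q" by (rule minimal)
    then show ?thesis using le[of 1 x] by simp
  qed
  have add: "q (x + y) = q x + q y" for x y
    using super[of x y] sublinear_add[OF q, of x y] by simp
  have neg: "q (- x) = - q x" for x
    using add[of x "- x"] sublinear_zero[OF q] by simp
  have "q (t *\<^sub>R x) = t * q x" for t x
    using sublinear_scale[OF q, of t x] sublinear_scale[OF q, of "- t" x] neg[of "t *\<^sub>R x"]
    by (cases "0 \<le> t") auto
  then show ?thesis using add by (intro linearI) auto
qed

theorem Hahn_Banach_sublinear:
  fixes p :: "'v::real_vector \<Rightarrow> real"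
  assumes p: "sublinear p" and S: "subspace S"
    and add: "\<And>x y. x \<in> S \<Longrightarrow> y \<in> S \<Longrightarrow> f (x + y) = f x + f y"
    and scale: "\<And>t x. x \<in> S \<Longrightarrow> f (t *\<^sub>R x) = t * f x"
    and le: "\<And>x. x \<in> S \<Longrightarrow> f x \<le> p x"
  obtains g where "linear g" "\<And>x. x \<in> S \<Longrightarrow> g x = f x" "\<And>x. g x \<le> p x"
proof -
  \<comment> \<open>Every linear functional below \<open>r\<close> extends \<open>f\<close>, because \<open>r s \<le> f s\<close> for \<open>s \<in> S\<close>.\<close>
  define r where "r = (\<lambda>x. INF s\<in>S. p (x - s) + f s)"
  have f_neg: "f (- s) = - f s" if "s \<in> S" for s
    using scale[OF that, of "-1"] by simp
  have lower: "- p (- x) \<le> p (x - s) + f s" if "s \<in> S" for s x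
    using sublinear_diff_ge[OF p, of "- s" x] le[of "- s"] f_neg that subspace_neg[OF S] by fastforce
  have r_le: "r x \<le> p (x - s) + f s" if "s \<in> S" for s x
    unfolding r_def using lower that by (intro cINF_lower bdd_belowI2[where m = "- p (- x)"]) auto
  have "sublinear r"
    unfolding r_def
  proof (rule sublinear_INF[OF _ lower])
    show "S \<noteq> {}" using subspace_0[OF S] by auto
  next
    fix s t x y assume "s \<in> S" "t \<in> S"
    then show "\<exists>k\<in>S. p (x + y - k) + f k \<le> p (x - s) + f s + (p (y - t) + f t)"
      using sublinear_add[OF p, of "x - s" "y - t"] subspace_add[OF S] add
      by (intro bexI[of _ "s + t"]) (auto simp: algebra_simps)
  next
    fix s x and t :: real assume "s \<in> S" "0 < t"
    then show "\<exists>k\<in>S. p (t *\<^sub>R x - k) + f k \<le> t * (p (x - s) + f s)"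
      using sublinear_scale[OF p, of t "x - s"] subspace_scale[OF S] scale
      by (intro bexI[of _ "t *\<^sub>R s"]) (auto simp: algebra_simps)
  qed auto
  then obtain g where g: "sublinear g" "g \<le> r" "\<And>r. sublinear r \<Longrightarrow> r \<le> g \<Longrightarrow> r = g"
    using ex_minimal_sublinear by metis
  have lin: "linear g"
    using minimal_sublinear_linear g by blast
  have g_le: "g s \<le> f s" if "s \<in> S" for s
    using le_funD[OF g(2), of s] r_le[OF that, of s] sublinear_zero[OF p] by simp
  show thesis
  proof
    \<comment> \<open>Both \<open>f\<close> and \<open>g\<close> are odd on \<open>S\<close>, so
      \<open>g_le\<close> at \<open>- s\<close> is the reverse inequality.\<close>
    show "g s = f s" if "s \<in> S" for s
      using g_le[OF that] g_le[of "- s"] f_neg[OF that] subspace_neg[OF S that] linear_neg[OF lin, of s]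
      by simp
    show "g x \<le> p x" for x
      using le_funD[OF g(2), of x] r_le[OF subspace_0[OF S], of x] scale[OF subspace_0[OF S], of 0]
      by simp
  qed (rule lin)
qed

text \<open>The dominating functional \<open>B * norm x\<close> is even, so the one-sided bound on
  the extension already bounds its absolute value.\<close>

lemma Hahn_Banach_norm:
  fixes f :: "'a::real_normed_vector \<Rightarrow> real"
  assumes S: "subspace S"
    and add: "\<And>x y. x \<in> S \<Longrightarrow> y \<in> S \<Longrightarrow> f (x + y) = f x + f y"
    and scale: "\<And>t x. x \<in> S \<Longrightarrow> f (t *\<^sub>R x) = t * f x"
    and le: "\<And>x. x \<in> S \<Longrightarrow> f x \<le> B * norm x" and B: "0 \<le> B"
  obtains g :: "'a \<Rightarrow>\<^sub>L real" where "\<And>x. x \<in> S \<Longrightarrow> blinfun_apply g x = f x" "norm g \<le> B"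
proof -
  have "sublinear (\<lambda>x::'a. B * norm x)"
  proof (rule sublinearI)
    show "B * norm (x + y) \<le> B * norm x + B * norm y" for x y :: 'a
      using mult_left_mono[OF norm_triangle_ineq B] by (simp add: distrib_left)
  qed auto
  then obtain g where g: "linear g" "\<And>x. x \<in> S \<Longrightarrow> g x = f x" "\<And>x. g x \<le> B * norm x"
    by (rule Hahn_Banach_sublinear[where S = S and f = f]) (use S add scale le in auto)
  have abs: "\<bar>g x\<bar> \<le> B * norm x" for x
    using g(3)[of x] g(3)[of "- x"] linear_neg[OF g(1), of x] by (simp add: abs_le_iff)
  then have "bounded_linear g"
    using g(1) by (intro bounded_linear_intro[where K = B])
      (auto simp: linear_add linear_cmul mult.commute)
  then show thesis
    using g abs B by (intro that[of "Blinfun g"] norm_blinfun_bound)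
      (auto simp: bounded_linear_Blinfun_apply)
qed

text \<open>A minimal sublinear functional below the limsup is linear and serves as the limit. The
  limsup \<open>p\<close> is written as the infimum of the set \<open>E a\<close> of eventual upper
  bounds. The result is a total function on sequences, controlled on the bounded ones.\<close>

lemma ex_Banach_limit:
  obtains \<Lambda> :: "(nat \<Rightarrow> real) \<Rightarrow> real"
  where "\<And>u v. Bseq u \<Longrightarrow> Bseq v \<Longrightarrow> \<Lambda> (\<lambda>n. u n + v n) = \<Lambda> u + \<Lambda> v"
    and "\<And>u c. Bseq u \<Longrightarrow> \<Lambda> (\<lambda>n. c * u n) = c * \<Lambda> u"
    and "\<And>u r. Bseq u \<Longrightarrow> eventually (\<lambda>n. u n \<le> r) sequentially \<Longrightarrow> \<Lambda> u \<le> r"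
proof -
  define E :: "(nat \<Rightarrow>\<^sub>C real) \<Rightarrow> real set"
    where "E = (\<lambda>a. {r. eventually (\<lambda>n. apply_bcontfun a n \<le> r) sequentially})"
  define p where "p = (\<lambda>a. Inf (E a))"
  have lower: "- norm a \<le> r" if r: "r \<in> E a" for a r
  proof -
    obtain n where "apply_bcontfun a n \<le> r"
      using r unfolding E_def eventually_sequentially by blast
    then show ?thesis using norm_bounded[of a n] by (simp add: abs_le_iff)
  qed
  have bdd: "bdd_below (E a)" for a
    using lower by (auto intro!: bdd_belowI)
  have ne: "E a \<noteq> {}" for a
  proof -
    have "norm a \<in> E a"
      using norm_bounded[of a] by (auto simp: E_def abs_le_iff intro!: always_eventually)
    then show ?thesis by blast
  qed
  have p_Inf: "p a = Inf (E a)" for a by (simp add: p_def)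
  have p_le: "p a \<le> r" if "r \<in> E a" for a r
    unfolding p_Inf using bdd that by (intro cInf_lower)
  have sub: "sublinear p"
  proof (rule sublinearI)
    fix a b :: "nat \<Rightarrow>\<^sub>C real"
    show "p (a + b) \<le> p a + p b"
    proof (rule field_le_epsilon)
      fix e :: real assume "0 < e"
      then obtain r s where r: "r \<in> E a" "r < p a + e / 2" and s: "s \<in> E b" "s < p b + e / 2"
        using cInf_lessD[OF ne, of a "p a + e / 2"] cInf_lessD[OF ne, of b "p b + e / 2"]
        by (auto simp: p_Inf)
      have "r + s \<in> E (a + b)"
        using r(1) s(1) unfolding E_def by (auto elim: eventually_elim2)
      then show "p (a + b) \<le> p a + p b + e"
        using p_le[of "r + s" "a + b"] r s by simp
    qed
    fix t :: real assume t: "0 < t"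
    have "p (t *\<^sub>R a) / t \<le> Inf (E a)"
    proof (rule cInf_greatest[OF ne])
      fix r assume "r \<in> E a"
      then have "t * r \<in> E (t *\<^sub>R a)"
        using t unfolding E_def by (auto elim: eventually_mono)
      then show "p (t *\<^sub>R a) / t \<le> r"
        using p_le t by (fastforce simp: field_simps)
    qed
    then show "p (t *\<^sub>R a) \<le> t * p a"
      using t by (simp add: p_Inf field_simps)
  qed
  obtain g where g: "linear g" "\<And>a. g a \<le> p a"
    using minimal_sublinear_linear ex_minimal_sublinear[OF sub] by (metis le_funD)
  \<comment> \<open>Every function on the discrete space of naturals is continuous, so
    \<open>Bcontfun\<close> represents each bounded sequence faithfully.\<close>
  have app: "apply_bcontfun (Bcontfun u) = u" if "Bseq u" for u :: "nat \<Rightarrow> real"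
    using that by (intro Bcontfun_inverse) (auto simp: bcontfun_def Bseq_eq_bounded)
  show thesis
  proof (rule that[of "\<lambda>u. g (Bcontfun u)"])
    fix u v :: "nat \<Rightarrow> real" assume "Bseq u" "Bseq v"
    moreover have "Bseq (\<lambda>n. u n + v n)"
      using calculation unfolding Bseq_eq_bounded by (rule bounded_plus_comp)
    ultimately have "Bcontfun (\<lambda>n. u n + v n) = Bcontfun u + Bcontfun v"
      by (intro bcontfun_eqI) (simp add: app)
    then show "g (Bcontfun (\<lambda>n. u n + v n)) = g (Bcontfun u) + g (Bcontfun v)"
      using g(1) by (simp add: linear_add)
  next
    fix u :: "nat \<Rightarrow> real" and c assume "Bseq u"
    moreover have "Bseq (\<lambda>n. c * u n)"
      using \<open>Bseq u\<close> by (intro Bseq_mult Bfun_const)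
    ultimately have "Bcontfun (\<lambda>n. c * u n) = c *\<^sub>R Bcontfun u"
      by (intro bcontfun_eqI) (simp add: app)
    then show "g (Bcontfun (\<lambda>n. c * u n)) = c * g (Bcontfun u)"
      using g(1) by (simp add: linear_cmul)
  next
    fix u :: "nat \<Rightarrow> real" and r assume "Bseq u" "eventually (\<lambda>n. u n \<le> r) sequentially"
    then have "r \<in> E (Bcontfun u)" by (simp add: E_def app)
    then show "g (Bcontfun u) \<le> r" using p_le g(2) order_trans by blast
  qed
qed

lemma ex_Banach_limit_abs:
  obtains \<Lambda> :: "(nat \<Rightarrow> real) \<Rightarrow> real"
  where "\<And>u v. Bseq u \<Longrightarrow> Bseq v \<Longrightarrow> \<Lambda> (\<lambda>n. u n + v n) = \<Lambda> u + \<Lambda> v"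
    and "\<And>u c. Bseq u \<Longrightarrow> \<Lambda> (\<lambda>n. c * u n) = c * \<Lambda> u"
    and "\<And>u r. Bseq u \<Longrightarrow> eventually (\<lambda>n. \<bar>u n\<bar> \<le> r) sequentially \<Longrightarrow> \<bar>\<Lambda> u\<bar> \<le> r"
    and "\<And>u r. Bseq u \<Longrightarrow> eventually (\<lambda>n. u n = r) sequentially \<Longrightarrow> \<Lambda> u = r"
proof -
  obtain \<Lambda> :: "(nat \<Rightarrow> real) \<Rightarrow> real"
    where add: "\<And>u v. Bseq u \<Longrightarrow> Bseq v \<Longrightarrow> \<Lambda> (\<lambda>n. u n + v n) = \<Lambda> u + \<Lambda> v"
      and scale: "\<And>u c. Bseq u \<Longrightarrow> \<Lambda> (\<lambda>n. c * u n) = c * \<Lambda> u"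
      and le: "\<And>u r. Bseq u \<Longrightarrow> eventually (\<lambda>n. u n \<le> r) sequentially \<Longrightarrow> \<Lambda> u \<le> r"
    by (rule ex_Banach_limit) blast
  have ge: "r \<le> \<Lambda> u" if u: "Bseq u" and ev: "eventually (\<lambda>n. r \<le> u n) sequentially" for u r
  proof -
    have "Bseq (\<lambda>n. (- 1) * u n)" using u by (intro Bseq_mult Bfun_const)
    moreover have "eventually (\<lambda>n. (- 1) * u n \<le> - r) sequentially"
      using ev by (rule eventually_mono) simp
    ultimately show ?thesis using le[of "\<lambda>n. (- 1) * u n" "- r"] scale[OF u, of "- 1"] by simp
  qed
  show thesis
  proof (rule that[of \<Lambda>])
    fix u :: "nat \<Rightarrow> real" and r assume u: "Bseq u"
    {
      assume ev: "eventually (\<lambda>n. \<bar>u n\<bar> \<le> r) sequentially"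
      have "\<Lambda> u \<le> r" by (rule le[OF u]) (rule eventually_mono[OF ev], simp)
      moreover have "- r \<le> \<Lambda> u" by (rule ge[OF u]) (rule eventually_mono[OF ev], simp)
      ultimately show "\<bar>\<Lambda> u\<bar> \<le> r" by simp
    next
      assume ev: "eventually (\<lambda>n. u n = r) sequentially"
      have "\<Lambda> u \<le> r" by (rule le[OF u]) (rule eventually_mono[OF ev], simp)
      moreover have "r \<le> \<Lambda> u" by (rule ge[OF u]) (rule eventually_mono[OF ev], simp)
      ultimately show "\<Lambda> u = r" by simp
    }
  qed (use add scale in auto)
qed

subsection \<open>Rosenthal's theorem\<close>

text \<open>
  \<open>settles A B M L\<close>: the pairs \<open>(A n, B n)\<close> with \<open>n \<in> M\<close> converge in Rosenthal's sense on \<open>L\<close>, i.e.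
  no point of \<open>L\<close> lies in infinitely many \<open>A n\<close> and in infinitely many \<open>B n\<close>.
\<close>

definition settles :: "(nat \<Rightarrow> 'k set) \<Rightarrow> (nat \<Rightarrow> 'k set) \<Rightarrow> nat set \<Rightarrow> 'k set \<Rightarrow> bool" where
  "settles A B M L \<longleftrightarrow> (\<forall>t\<in>L. finite {n\<in>M. t \<in> A n} \<or> finite {n\<in>M. t \<in> B n})"

text \<open>The hereditary form of non-convergence: it passes to every subset of \<open>P\<close>,
  which allows successive refinements. It is vacuous for finite \<open>P\<close>, so infinitude is
  carried separately.\<close>

definition unsettled :: "(nat \<Rightarrow> 'k set) \<Rightarrow> (nat \<Rightarrow> 'k set) \<Rightarrow> nat set \<Rightarrow> 'k set \<Rightarrow> bool" where
  "unsettled A B P L \<longleftrightarrow> (\<forall>M\<subseteq>P. infinite M \<longrightarrow> \<not> settles A B M L)"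

text \<open>Finitely many extra indices do not affect finiteness, so almost inclusion of
  \<open>M'\<close> in \<open>M\<close> is enough.\<close>

lemma settles_mono: "settles A B M L \<Longrightarrow> finite (M' - M) \<Longrightarrow> settles A B M' L"
  unfolding settles_def
proof (intro ballI)
  fix t assume *: "\<forall>t\<in>L. finite {n\<in>M. t \<in> A n} \<or> finite {n\<in>M. t \<in> B n}" "finite (M' - M)" "t \<in> L"
  have "{n\<in>M'. t \<in> C n} \<subseteq> {n\<in>M. t \<in> C n} \<union> (M' - M)" for C :: "nat \<Rightarrow> 'a set" by auto
  then show "finite {n\<in>M'. t \<in> A n} \<or> finite {n\<in>M'. t \<in> B n}"
    using * by (meson finite_UnI finite_subset)
qed

text \<open>The core of Rosenthal's argument. If no such \<open>n\<close> and \<open>M\<close>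
  existed, each index \<open>n\<close> and each infinite \<open>M\<close> would admit an infinite
  part of \<open>M\<close> that settles one half, \<open>A\<close> or \<open>B\<close>, of some
  \<open>L\<close>. Iterating gives decreasing sets \<open>M k\<close> and indices
  \<open>n k\<close>; since \<open>\<L>\<close> is finite, one set \<open>L0\<close> and one side
  \<open>b0\<close> recur infinitely often, and the corresponding indices settle \<open>L0\<close>,
  a contradiction.\<close>

lemma unsettled_split:
  fixes A B :: "nat \<Rightarrow> 'k set"
  assumes P: "infinite P" and fin: "finite \<L>" and uns: "\<And>L. L \<in> \<L> \<Longrightarrow> unsettled A B P L"
  shows "\<exists>n\<in>P. \<exists>M\<subseteq>P. infinite M \<and> (\<forall>L\<in>\<L>. unsettled A B M (L \<inter> A n) \<and> unsettled A B M (L \<inter> B n))"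
proof (rule ccontr)
  define C where "C = (\<lambda>b n. if b then A n else B n)"
  assume neg: "\<not> ?thesis"
  have step: "\<exists>M' L b. M' \<subseteq> M \<inter> {n<..} \<and> infinite M' \<and> L \<in> \<L> \<and> settles A B M' (L \<inter> C b n)"
    if n: "n \<in> P" and M: "M \<subseteq> P" "infinite M" for n M
  proof -
    obtain L where L: "L \<in> \<L>" "\<not> (unsettled A B M (L \<inter> A n) \<and> unsettled A B M (L \<inter> B n))"
      using neg n M by blast
    then obtain b where b: "\<not> unsettled A B M (L \<inter> C b n)"
      unfolding C_def by (metis (full_types))
    then obtain M' where M': "M' \<subseteq> M" "infinite M'" "settles A B M' (L \<inter> C b n)"
      by (auto simp: unsettled_def)
    \<comment> \<open>Cutting off the indices up to \<open>n\<close> makes the chosen indices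
      strictly increasing.\<close>
    have "finite (M' \<inter> {..n})" by simp
    moreover have "M' = M' \<inter> {n<..} \<union> M' \<inter> {..n}" by auto
    ultimately have inf: "infinite (M' \<inter> {n<..})" using M'(2) by (metis finite_UnI)
    have "settles A B (M' \<inter> {n<..}) (L \<inter> C b n)"
      using M'(3) by (rule settles_mono) (auto intro: finite_subset[of _ "{}"])
    then show ?thesis using inf M'(1) L(1) by blast
  qed
  define good where "good = (\<lambda>(n, M, L, b). n \<in> P \<and> M \<subseteq> P \<inter> {n<..} \<and> infinite M \<and> L \<in> \<L>
      \<and> settles A B M (L \<inter> C b n))"
  have "\<exists>f. \<forall>k. good (f k) \<and> fst (f (Suc k)) \<in> fst (snd (f k)) \<and> fst (snd (f (Suc k))) \<subseteq> fst (snd (f k))"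
  proof (rule dependent_nat_choice)
    obtain n where "n \<in> P" using infinite_imp_nonempty[OF P] by blast
    then obtain M' L b where "M' \<subseteq> P \<inter> {n<..}" "infinite M'" "L \<in> \<L>" "settles A B M' (L \<inter> C b n)"
      using step[of n P] P by blast
    then show "\<exists>x. good x"
      using \<open>n \<in> P\<close> by (intro exI[of _ "(n, M', L, b)"]) (simp add: good_def)
  next
    fix x :: "nat \<times> nat set \<times> 'k set \<times> bool" and k :: nat assume g: "good x"
    obtain n M L b where x: "x = (n, M, L, b)" by (metis prod_cases4)
    have M: "M \<subseteq> P" "infinite M" using g by (auto simp: good_def x)
    then obtain n' where n': "n' \<in> M" using infinite_imp_nonempty by blast
    then obtain M' L' b' where "M' \<subseteq> M \<inter> {n'<..}" "infinite M'" "L' \<in> \<L>" "settles A B M' (L' \<inter> C b' n')"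
      using step[of n' M] M by blast
    then show "\<exists>y. good y \<and> fst y \<in> fst (snd x) \<and> fst (snd y) \<subseteq> fst (snd x)"
      using M n' by (intro exI[of _ "(n', M', L', b')"]) (auto simp: good_def x)
  qed
  then obtain f where f: "\<And>k. good (f k)" "\<And>k. fst (f (Suc k)) \<in> fst (snd (f k))"
    "\<And>k. fst (snd (f (Suc k))) \<subseteq> fst (snd (f k))" by blast
  define n M L b where "n = (\<lambda>k. fst (f k))" and "M = (\<lambda>k. fst (snd (f k)))"
    and "L = (\<lambda>k. fst (snd (snd (f k))))" and "b = (\<lambda>k. snd (snd (snd (f k))))"
  have f_eq: "f k = (n k, M k, L k, b k)" for k by (simp add: n_def M_def L_def b_def)
  have nP: "n k \<in> P" and MP: "M k \<subseteq> P \<inter> {n k<..}"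
    and LL: "L k \<in> \<L>" and sett: "settles A B (M k) (L k \<inter> C (b k) (n k))" for k
    using f(1)[of k] by (auto simp: good_def f_eq)
  have nM: "n (Suc k) \<in> M k" for k using f(2)[of k] by (simp add: f_eq)
  have "decseq M" using f(3) by (intro decseq_SucI) (simp add: f_eq)
  \<comment> \<open>All but the first few chosen indices lie in \<open>M k\<close>, so whatever
    \<open>M k\<close> settles is settled by the whole index sequence.\<close>
  have nM': "n i \<in> M k" if "k < i" for i k
  proof -
    have "n (Suc (i - 1)) \<in> M (i - 1)" by (rule nM)
    moreover have "M (i - 1) \<subseteq> M k"
      using decseqD[OF \<open>decseq M\<close>, of k "i - 1"] that by simp
    ultimately show ?thesis using that by auto
  qed
  have mono: "strict_mono n"
  proof (rule strict_monoI_Suc)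
    show "n k < n (Suc k)" for k using nM[of k] MP[of k] by auto
  qed
  \<comment> \<open>Pigeonhole on the pairs of a set in \<open>\<L>\<close> and a side.\<close>
  obtain c where c: "infinite ((\<lambda>k. (L k, b k)) -` {c})"
  proof -
    have "range (\<lambda>k. (L k, b k)) \<subseteq> \<L> \<times> UNIV" using LL by auto
    then have "finite (range (\<lambda>k. (L k, b k)))"
      by (rule finite_subset) (simp add: fin)
    from inf_img_fin_dom[OF this] obtain c where "infinite ((\<lambda>k. (L k, b k)) -` {c})" by auto
    then show thesis using that by blast
  qed
  obtain L0 b0 where c0: "c = (L0, b0)" by fastforce
  define J where "J = (\<lambda>k. (L k, b k)) -` {c}"
  have J: "infinite J" "\<And>j. j \<in> J \<Longrightarrow> L j = L0 \<and> b j = b0"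
    using c by (auto simp: J_def c0)
  have infn: "infinite (n ` J)"
    using J(1) finite_imageD[of n J] inj_on_subset[OF strict_mono_imp_inj_on[OF mono]] by blast
  \<comment> \<open>A point of \<open>L0\<close> lying in some \<open>C b0 (n j)\<close>, \<open>j \<in> J\<close>, is settled by \<open>M j\<close>, which contains
    almost all of \<open>n ` J\<close>; any other point lies in no \<open>C b0 (n j)\<close> at all.\<close>
  have "settles A B (n ` J) L0"
    unfolding settles_def
  proof
    fix t assume t: "t \<in> L0"
    show "finite {m \<in> n ` J. t \<in> A m} \<or> finite {m \<in> n ` J. t \<in> B m}"
    proof (cases "\<exists>j\<in>J. t \<in> C b0 (n j)")
      case True
      then obtain j where j: "j \<in> J" "t \<in> C b0 (n j)" by blast
      have "settles A B (M j) (L0 \<inter> C b0 (n j))" using sett[of j] J(2)[OF j(1)] by simp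
      moreover have "n ` J - M j \<subseteq> n ` {..j}"
      proof
        fix m assume "m \<in> n ` J - M j"
        then obtain i where "m = n i" "n i \<notin> M j" by blast
        then show "m \<in> n ` {..j}" using nM'[of j i] by (cases "j < i") auto
      qed
      then have "finite (n ` J - M j)" by (rule finite_subset) simp
      ultimately have "settles A B (n ` J) (L0 \<inter> C b0 (n j))" by (rule settles_mono)
      then show ?thesis using j t by (auto simp: settles_def)
    next
      case False
      then have "{m \<in> n ` J. t \<in> C b0 m} = {}" by auto
      then have "finite {m \<in> n ` J. t \<in> C b0 m}" by (simp only: finite.emptyI)
      then show ?thesis by (cases b0) (simp_all only: C_def if_True if_False simp_thms)
    qed
  qed
  moreover obtain j where "j \<in> J" using infinite_imp_nonempty[OF J(1)] by blast
  then have "L0 \<in> \<L>" using J(2)[of j] LL[of j] by simp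
  moreover have "n ` J \<subseteq> P" using nP by auto
  ultimately show False using uns infn by (auto simp: unsettled_def)
qed

lemma unsettled_nonempty: "infinite P \<Longrightarrow> unsettled A B P L \<Longrightarrow> L \<noteq> {}"
  by (auto simp: unsettled_def settles_def)

text \<open>Iterates \<open>unsettled_split\<close> on the family of all Boolean intersections of
  the pairs chosen so far. Every member stays unsettled on the remaining infinite index set and is
  therefore nonempty, which is independence; \<open>S\<close> encodes the pattern of sides.\<close>

lemma ex_independent_subsequence:
  fixes A B :: "nat \<Rightarrow> 'k set"
  assumes P: "infinite P" and uns: "unsettled A B P K"
  obtains \<sigma> :: "nat \<Rightarrow> nat" where "strict_mono \<sigma>" "range \<sigma> \<subseteq> P"
    and "\<forall>N S. \<exists>t\<in>K. \<forall>j<N. if j \<in> S then t \<in> A (\<sigma> j) else t \<in> B (\<sigma> j)"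
proof -
  define good where "good = (\<lambda>(n::nat, M, \<L>). M \<subseteq> P \<inter> {n<..} \<and> infinite M \<and> finite \<L> \<and> (\<forall>L\<in>\<L>. unsettled A B M L))"
  define next_ok where "next_ok = (\<lambda>(n :: nat, M, \<L>) (n', M', \<L>'). n' \<in> M \<and> M' \<subseteq> M
      \<and> \<L>' = (\<lambda>L. L \<inter> A n') ` \<L> \<union> (\<lambda>L. L \<inter> B n') ` \<L>)"
  have step: "\<exists>n' M' \<L>'. n' \<in> M \<and> M' \<subseteq> M \<and> good (n', M', \<L>') \<and> \<L>' = (\<lambda>L. L \<inter> A n') ` \<L> \<union> (\<lambda>L. L \<inter> B n') ` \<L>"
    if M: "M \<subseteq> P" "infinite M" "finite \<L>" "\<forall>L\<in>\<L>. unsettled A B M L" for M \<L>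
  proof -
    obtain n' M' where n': "n' \<in> M" "M' \<subseteq> M" "infinite M'"
      "\<forall>L\<in>\<L>. unsettled A B M' (L \<inter> A n') \<and> unsettled A B M' (L \<inter> B n')"
      using unsettled_split[of M \<L> A B] M by blast
    have "finite (M' \<inter> {..n'})" by simp
    moreover have "M' = M' \<inter> {n'<..} \<union> M' \<inter> {..n'}" by auto
    ultimately have inf: "infinite (M' \<inter> {n'<..})" using n'(3) by (metis finite_UnI)
    have "unsettled A B (M' \<inter> {n'<..}) L" if "unsettled A B M' L" for L
      using that by (auto simp: unsettled_def)
    then have "good (n', M' \<inter> {n'<..}, (\<lambda>L. L \<inter> A n') ` \<L> \<union> (\<lambda>L. L \<inter> B n') ` \<L>)"
      using inf n' M by (auto simp: good_def)
    then show ?thesis using n' by blast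
  qed
  define start where "start = (\<lambda>(n', M' :: nat set, \<L>'). \<L>' = {K \<inter> A n', K \<inter> B n'})"
  have "\<exists>f. \<forall>k. (good (f k) \<and> (k = 0 \<longrightarrow> start (f k))) \<and> next_ok (f k) (f (Suc k))"
  proof (rule dependent_nat_choice)
    show "\<exists>x. good x \<and> (0 = (0::nat) \<longrightarrow> start x)"
    proof -
      obtain n' M' \<L>' where "good (n', M', \<L>')" "\<L>' = (\<lambda>L. L \<inter> A n') ` {K} \<union> (\<lambda>L. L \<inter> B n') ` {K}"
        using step[of P "{K}"] P uns by blast
      then show ?thesis
        by (intro exI[of _ "(n', M', \<L>')"]) (auto simp: start_def)
    qed
  next
    fix x :: "nat \<times> nat set \<times> 'k set set" and k :: nat
    assume g: "good x \<and> (k = 0 \<longrightarrow> start x)"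
    obtain n M \<L> where x: "x = (n, M, \<L>)" by (metis prod_cases3)
    have "M \<subseteq> P" "infinite M" "finite \<L>" "\<forall>L\<in>\<L>. unsettled A B M L"
      using g by (auto simp: good_def x)
    from step[OF this] obtain n' M' \<L>' where "n' \<in> M" "M' \<subseteq> M" "good (n', M', \<L>')"
      "\<L>' = (\<lambda>L. L \<inter> A n') ` \<L> \<union> (\<lambda>L. L \<inter> B n') ` \<L>" by blast
    then show "\<exists>y. (good y \<and> (Suc k = 0 \<longrightarrow> start y)) \<and> next_ok x y"
      by (intro exI[of _ "(n', M', \<L>')"]) (simp add: x next_ok_def)
  qed
  then obtain f where f: "\<And>k. good (f k)" "start (f 0)" "\<And>k. next_ok (f k) (f (Suc k))" by blast
  define n M \<L> where "n = (\<lambda>k. fst (f k))" and "M = (\<lambda>k. fst (snd (f k)))"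
    and "\<L> = (\<lambda>k. snd (snd (f k)))"
  have f_eq: "f k = (n k, M k, \<L> k)" for k by (simp add: n_def M_def \<L>_def)
  have mem: "K \<inter> (\<Inter>j\<le>k. if j \<in> S then A (n j) else B (n j)) \<in> \<L> k" for k S
  proof (induction k)
    case 0
    then show ?case using f(2) by (cases "0 \<in> S") (auto simp: start_def f_eq)
  next
    case (Suc k)
    have "K \<inter> (\<Inter>j\<le>Suc k. if j \<in> S then A (n j) else B (n j)) =
        K \<inter> (\<Inter>j\<le>k. if j \<in> S then A (n j) else B (n j)) \<inter>
        (if Suc k \<in> S then A (n (Suc k)) else B (n (Suc k)))"
      by (auto simp: atMost_Suc)
    moreover have "\<L> (Suc k) = (\<lambda>L. L \<inter> A (n (Suc k))) ` \<L> k \<union> (\<lambda>L. L \<inter> B (n (Suc k))) ` \<L> k"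
      using f(3)[of k] by (simp add: next_ok_def f_eq)
    ultimately show ?case using Suc by auto
  qed
  show thesis
  proof
    \<comment> \<open>The subsequence starts at \<open>n 1\<close>: \<open>good\<close> does not
      record that \<open>n 0\<close> lies in \<open>P\<close>, whereas
      \<open>n (Suc k) \<in> M k\<close> and \<open>M k \<subseteq> P\<close>.\<close>
    show "strict_mono (\<lambda>k. n (Suc k))"
    proof (rule strict_monoI_Suc)
      fix k show "n (Suc k) < n (Suc (Suc k))"
        using f(3)[of "Suc k"] f(1)[of "Suc k"] by (auto simp: next_ok_def good_def f_eq)
    qed
    show "range (\<lambda>k. n (Suc k)) \<subseteq> P"
      using f(1,3) by (fastforce simp: next_ok_def good_def f_eq)
    show "\<forall>N S. \<exists>t\<in>K. \<forall>j<N. if j \<in> S then t \<in> A (n (Suc j)) else t \<in> B (n (Suc j))"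
    proof (intro allI)
      fix N :: nat and S :: "nat set"
      \<comment> \<open>The pattern is shifted accordingly; index 0 falls on the \<open>B\<close>
        side by default and is dropped afterwards.\<close>
      have "K \<inter> (\<Inter>j\<le>N. if j \<in> Suc ` S then A (n j) else B (n j)) \<noteq> {}"
        using mem[of "Suc ` S" N] f(1)[of N] unsettled_nonempty by (fastforce simp: good_def f_eq)
      then obtain t where t: "t \<in> K" "t \<in> (\<Inter>j\<le>N. if j \<in> Suc ` S then A (n j) else B (n j))"
        by blast
      have "if j \<in> S then t \<in> A (n (Suc j)) else t \<in> B (n (Suc j))" if "j < N" for j
        using INT_D[OF t(2), of "Suc j"] that by (auto simp: inj_image_mem_iff split: if_splits)
      then show "\<exists>t\<in>K. \<forall>j<N. if j \<in> S then t \<in> A (n (Suc j)) else t \<in> B (n (Suc j))"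
        using t(1) by blast
    qed
  qed
qed

text \<open>The embedding is \<open>a \<mapsto> \<Sum>n. a n *\<^sub>R e n\<close>. The series
  converges absolutely, hence in the Banach space, and the lower estimate for finite sums passes to
  the limit.\<close>

lemma contains_l1I:
  fixes e :: "nat \<Rightarrow> 'a::banach"
  assumes B: "\<And>n. norm (e n) \<le> B" and c: "0 < c"
    and lower: "\<And>N a. c * (\<Sum>n<N. \<bar>a n\<bar>) \<le> norm (\<Sum>n<N. a n *\<^sub>R e n)"
  shows "contains_l1 TYPE('a)"
proof -
  define T where "T = (\<lambda>a. \<Sum>n. a n *\<^sub>R e n)"
  have bnd: "norm (a n *\<^sub>R e n) \<le> B * \<bar>a n\<bar>" for a n
    using mult_left_mono[OF B[of n], of "\<bar>a n\<bar>"] by (simp add: mult.commute)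
  have norm_summable: "summable (\<lambda>n. norm (a n *\<^sub>R e n))" if "a \<in> l1" for a
  proof (rule summable_comparison_test)
    show "summable (\<lambda>n. B * \<bar>a n\<bar>)"
      using that by (simp add: l1_def summable_mult)
    show "\<exists>N. \<forall>n\<ge>N. norm (norm (a n *\<^sub>R e n)) \<le> B * \<bar>a n\<bar>"
      using bnd[of a] by simp
  qed
  have summ: "summable (\<lambda>n. a n *\<^sub>R e n)" if "a \<in> l1" for a
    using summable_norm_cancel[OF norm_summable[OF that]] .
  have "T (\<lambda>n. r * a n + s * b n) = r *\<^sub>R T a + s *\<^sub>R T b" if "a \<in> l1" "b \<in> l1" for a b r s
  proof -
    have "(\<lambda>n. r *\<^sub>R (a n *\<^sub>R e n) + s *\<^sub>R (b n *\<^sub>R e n)) sums (r *\<^sub>R T a + s *\<^sub>R T b)"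
      unfolding T_def using summ that by (intro sums_add sums_scaleR_right summable_sums)
    then show ?thesis
      unfolding T_def by (simp add: scaleR_add_left sums_iff)
  qed
  moreover have "c * l1norm a \<le> norm (T a)" if "a \<in> l1" for a
  proof (rule LIMSEQ_le)
    have "(\<lambda>n. \<bar>a n\<bar>) sums l1norm a"
      using that by (simp add: l1_def l1norm_def summable_sums)
    then show "(\<lambda>N. c * (\<Sum>n<N. \<bar>a n\<bar>)) \<longlonglongrightarrow> c * l1norm a"
      unfolding sums_def by (intro tendsto_mult_left)
    have "(\<lambda>N. \<Sum>n<N. a n *\<^sub>R e n) \<longlonglongrightarrow> T a"
      using summable_sums[OF summ[OF that]] by (simp add: T_def sums_def)
    then show "(\<lambda>N. norm (\<Sum>n<N. a n *\<^sub>R e n)) \<longlonglongrightarrow> norm (T a)"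
      by (rule tendsto_norm)
  qed (use lower in auto)
  moreover have "norm (T a) \<le> B * l1norm a" if "a \<in> l1" for a
  proof -
    have "norm (T a) \<le> (\<Sum>n. norm (a n *\<^sub>R e n))"
      unfolding T_def by (rule summable_norm[OF norm_summable[OF that]])
    also have "\<dots> \<le> (\<Sum>n. B * \<bar>a n\<bar>)"
      using that by (intro suminf_le bnd norm_summable) (auto simp: l1_def intro: summable_mult)
    also have "\<dots> = B * l1norm a"
      using that by (simp add: l1_def l1norm_def suminf_mult)
    finally show ?thesis .
  qed
  ultimately show ?thesis
    unfolding contains_l1_def using c by blast
qed

text \<open>Only countably many rational pairs have to be tested, as a diagonal argument requires. A
  subsequence tends to some \<open>l\<close>; for rationals strictly between a bound and
  \<open>l\<close>, its behaviour excludes one alternative of \<open>osc\<close>, and the other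
  confines the whole sequence.\<close>

lemma convergent_if_no_oscillation:
  fixes u :: "nat \<Rightarrow> real"
  assumes bdd: "bounded (range u)"
    and osc: "\<And>r s :: rat. r < s \<Longrightarrow> (\<forall>\<^sub>F n in sequentially. u n \<le> of_rat s)
                \<or> (\<forall>\<^sub>F n in sequentially. of_rat r \<le> u n)"
  shows "convergent u"
proof -
  obtain l \<rho> where \<rho>: "strict_mono \<rho>" "(u \<circ> \<rho>) \<longlonglongrightarrow> l"
    using bounded_imp_convergent_subsequence[OF bdd] by blast
  have not_both: "\<not> (\<forall>\<^sub>F n in sequentially. Q (u n))"
    if R: "\<forall>\<^sub>F n in sequentially. R (u (\<rho> n))" and QR: "\<And>y. Q y \<Longrightarrow> R y \<Longrightarrow> False" for Q R
  proof
    assume "\<forall>\<^sub>F n in sequentially. Q (u n)"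
    with R have "\<forall>\<^sub>F n in sequentially. R (u (\<rho> n)) \<and> Q (u (\<rho> n))"
      using eventually_subseq[OF \<rho>(1)] eventually_conj by blast
    then have "\<forall>\<^sub>F n::nat in sequentially. False"
      by (rule eventually_mono) (use QR in blast)
    then show False by simp
  qed
  have "u \<longlonglongrightarrow> l"
  proof (rule order_tendstoI)
    fix a assume "a < l"
    then obtain r where "a < of_rat r" "of_rat r < l"
      using of_rat_dense by blast
    moreover from this obtain s where "(of_rat r :: real) < of_rat s" "of_rat s < l"
      using of_rat_dense by blast
    ultimately have rs: "a < of_rat r" "r < s" "of_rat s < l"
      by (auto simp: of_rat_less)
    have "\<forall>\<^sub>F n in sequentially. of_rat s < u (\<rho> n)"
      using order_tendstoD(1)[OF \<rho>(2) rs(3)] by simp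
    then have "\<not> (\<forall>\<^sub>F n in sequentially. u n \<le> of_rat s)"
      by (rule not_both) auto
    then have "\<forall>\<^sub>F n in sequentially. of_rat r \<le> u n"
      using osc[OF rs(2)] by blast
    then show "\<forall>\<^sub>F n in sequentially. a < u n"
      by (rule eventually_mono) (use rs in auto)
  next
    fix a assume "l < a"
    then obtain r where "l < of_rat r" "of_rat r < a"
      using of_rat_dense by blast
    moreover from this obtain s where "(of_rat r :: real) < of_rat s" "of_rat s < a"
      using of_rat_dense by blast
    ultimately have rs: "l < of_rat r" "r < s" "of_rat s < a"
      by (auto simp: of_rat_less)
    have "\<forall>\<^sub>F n in sequentially. u (\<rho> n) < of_rat r"
      using order_tendstoD(2)[OF \<rho>(2) rs(1)] by simp
    then have "\<not> (\<forall>\<^sub>F n in sequentially. of_rat r \<le> u n)"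
      by (rule not_both) auto
    then have "\<forall>\<^sub>F n in sequentially. u n \<le> of_rat s"
      using osc[OF rs(2)] by blast
    then show "\<forall>\<^sub>F n in sequentially. u n < a"
      by (rule eventually_mono) (use rs in auto)
  qed
  then show ?thesis by (auto simp: convergent_def)
qed

text \<open>Independence on the dual ball provides \<open>\<phi>\<close> above \<open>s\<close>
  where \<open>a j \<ge> 0\<close> and below \<open>r\<close> elsewhere, and \<open>\<psi>\<close>
  with the roles exchanged. Then \<open>\<phi> - \<psi>\<close> picks up at least
  \<open>(s - r) * \<bar>a j\<bar>\<close> from each term, and its norm is at most 2; hence the
  constant \<open>(s - r) / 2\<close>.\<close>

lemma contains_l1_if_unsettled:
  fixes x :: "nat \<Rightarrow> 'a::banach" and r s :: real
  assumes x: "\<And>n. norm (x n) \<le> 1" and rs: "r < s" and P: "infinite P"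
    and uns: "unsettled (\<lambda>n. {\<phi>. s < blinfun_apply \<phi> (x n)}) (\<lambda>n. {\<phi>. blinfun_apply \<phi> (x n) < r}) P {\<phi>. norm \<phi> \<le> 1}"
  shows "contains_l1 TYPE('a)"
proof -
  obtain \<sigma> :: "nat \<Rightarrow> nat" where "strict_mono \<sigma>" "range \<sigma> \<subseteq> P"
    and \<sigma>: "\<forall>N S. \<exists>\<phi>\<in>{\<phi>. norm \<phi> \<le> 1}. \<forall>j<N.
      if j \<in> S then \<phi> \<in> {\<phi>. s < blinfun_apply \<phi> (x (\<sigma> j))} else \<phi> \<in> {\<phi>. blinfun_apply \<phi> (x (\<sigma> j)) < r}"
    by (rule ex_independent_subsequence[OF P uns])
  have sep: "\<exists>\<phi>. norm \<phi> \<le> 1 \<and> (\<forall>j<N. if j \<in> S then s < blinfun_apply \<phi> (x (\<sigma> j)) else blinfun_apply \<phi> (x (\<sigma> j)) < r)" for N S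
    using spec[OF spec[OF \<sigma>, of N], of S] by (simp only: Bex_def mem_Collect_eq)
  show ?thesis
  proof (rule contains_l1I[where e = "\<lambda>n. x (\<sigma> n)" and B = 1 and c = "(s - r) / 2"])
    fix N and a :: "nat \<Rightarrow> real"
    from sep[of N "{j. 0 \<le> a j}"] obtain \<phi> where \<phi>: "norm \<phi> \<le> 1 \<and> (\<forall>j<N. if j \<in> {j. 0 \<le> a j}
      then s < blinfun_apply \<phi> (x (\<sigma> j)) else blinfun_apply \<phi> (x (\<sigma> j)) < r)" ..
    from sep[of N "{j. a j < 0}"] obtain \<psi> where \<psi>: "norm \<psi> \<le> 1 \<and> (\<forall>j<N. if j \<in> {j. a j < 0}
      then s < blinfun_apply \<psi> (x (\<sigma> j)) else blinfun_apply \<psi> (x (\<sigma> j)) < r)" ..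
    have term_ge: "(s - r) * \<bar>a j\<bar> \<le> a j * blinfun_apply (\<phi> - \<psi>) (x (\<sigma> j))" if "j < N" for j
    proof (cases "0 \<le> a j")
      case True
      then have "s - r \<le> blinfun_apply (\<phi> - \<psi>) (x (\<sigma> j))"
        using conjunct2[OF \<phi>, rule_format, OF that] conjunct2[OF \<psi>, rule_format, OF that]
        by (auto simp: blinfun.diff_left)
      then show ?thesis using True by (simp add: mult.commute mult_left_mono)
    next
      case False
      then have "s - r \<le> - blinfun_apply (\<phi> - \<psi>) (x (\<sigma> j))"
        using conjunct2[OF \<phi>, rule_format, OF that] conjunct2[OF \<psi>, rule_format, OF that]
        by (auto simp: blinfun.diff_left)
      from mult_left_mono[OF this, of "- a j"] show ?thesis using False by (simp add: mult.commute)
    qed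
    have "(s - r) * (\<Sum>j<N. \<bar>a j\<bar>) \<le> (\<Sum>j<N. a j * blinfun_apply (\<phi> - \<psi>) (x (\<sigma> j)))"
      unfolding sum_distrib_left by (intro sum_mono) (use term_ge in auto)
    also have "\<dots> = blinfun_apply (\<phi> - \<psi>) (\<Sum>j<N. a j *\<^sub>R x (\<sigma> j))"
      by (simp add: blinfun.sum_right blinfun.scaleR_right)
    also have "\<dots> \<le> norm (\<phi> - \<psi>) * norm (\<Sum>j<N. a j *\<^sub>R x (\<sigma> j))"
      using norm_blinfun[of "\<phi> - \<psi>" "\<Sum>j<N. a j *\<^sub>R x (\<sigma> j)"] by simp
    also have "\<dots> \<le> 2 * norm (\<Sum>j<N. a j *\<^sub>R x (\<sigma> j))"
      using norm_triangle_ineq4[of \<phi> \<psi>] conjunct1[OF \<phi>] conjunct1[OF \<psi>] by (intro mult_right_mono) auto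
    finally show "(s - r) / 2 * (\<Sum>n<N. \<bar>a n\<bar>) \<le> norm (\<Sum>n<N. a n *\<^sub>R x (\<sigma> n))"
      by simp
  qed (use x rs in auto)
qed

text \<open>Injectivity of \<open>\<sigma>\<close> turns finite sets of indices into statements that
  hold eventually along \<open>\<sigma>\<close>.\<close>

lemma settles_subseq_eventually:
  assumes "settles A B (range \<sigma>) L" "strict_mono \<sigma>" "t \<in> L"
  shows "(\<forall>\<^sub>F n in sequentially. t \<notin> A (\<sigma> n)) \<or> (\<forall>\<^sub>F n in sequentially. t \<notin> B (\<sigma> n))"
proof -
  have "\<forall>\<^sub>F n in sequentially. t \<notin> C (\<sigma> n)" if "finite {m\<in>range \<sigma>. t \<in> C m}" for C
  proof -
    have "\<sigma> ` {n. t \<in> C (\<sigma> n)} \<subseteq> {m\<in>range \<sigma>. t \<in> C m}" by auto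
    then have "finite (\<sigma> ` {n. t \<in> C (\<sigma> n)})" using that finite_subset by blast
    then have "finite {n. t \<in> C (\<sigma> n)}"
      using assms(2) by (meson finite_imageD strict_mono_imp_inj_on inj_on_subset subset_UNIV)
    then show ?thesis by (simp add: eventually_cofinite flip: cofinite_eq_sequentially)
  qed
  then show ?thesis using assms(1,3) unfolding settles_def by blast
qed

text \<open>Without a copy of l1 no subsequence is unsettled for any rational pair, so each pair can
  be handled by passing to a further subsequence. The diagonal sequence handles all pairs at once,
  which excludes oscillation.\<close>

theorem Rosenthal_l1:
  fixes x :: "nat \<Rightarrow> 'a::banach"
  assumes x: "\<And>n. norm (x n) \<le> 1" and no_l1: "\<not> contains_l1 TYPE('a)"
  obtains \<sigma> :: "nat \<Rightarrow> nat" where "strict_mono \<sigma>"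
    "\<And>\<phi> :: 'a \<Rightarrow>\<^sub>L real. convergent (\<lambda>k. blinfun_apply \<phi> (x (\<sigma> k)))"
proof -
  \<comment> \<open>All pairs of rationals are enumerated; those with \<open>r k \<ge> s k\<close>
    make \<open>Q k\<close> trivially true.\<close>
  define r s where "r = (\<lambda>k. fst (from_nat k :: rat \<times> rat))" and "s = (\<lambda>k. snd (from_nat k :: rat \<times> rat))"
  define Q where "Q = (\<lambda>k \<sigma>. r k < s k \<longrightarrow> (\<forall>\<phi>::'a \<Rightarrow>\<^sub>L real. norm \<phi> \<le> 1 \<longrightarrow>
    (\<forall>\<^sub>F n in sequentially. blinfun_apply \<phi> (x (\<sigma> n)) \<le> of_rat (s k)) \<or>
    (\<forall>\<^sub>F n in sequentially. of_rat (r k) \<le> blinfun_apply \<phi> (x (\<sigma> n)))))"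
  interpret subseqs Q
  proof
    fix k and \<sigma> :: "nat \<Rightarrow> nat" assume \<sigma>: "strict_mono \<sigma>"
    show "\<exists>\<rho>. strict_mono \<rho> \<and> Q k (\<sigma> \<circ> \<rho>)"
    proof (cases "r k < s k")
      case False
      then show ?thesis by (auto simp: Q_def intro!: exI[of _ id] strict_mono_id)
    next
      case True
      define A where "A = (\<lambda>n. {\<phi>::'a \<Rightarrow>\<^sub>L real. of_rat (s k) < blinfun_apply \<phi> (x n)})"
      define B where "B = (\<lambda>n. {\<phi>::'a \<Rightarrow>\<^sub>L real. blinfun_apply \<phi> (x n) < of_rat (r k)})"
      have "infinite (range \<sigma>)"
        using \<sigma> by (simp add: finite_image_iff strict_mono_imp_inj_on)
      then have "\<not> unsettled A B (range \<sigma>) {\<phi>. norm \<phi> \<le> 1}"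
        using contains_l1_if_unsettled[of x "real_of_rat (r k)" "real_of_rat (s k)"] x no_l1 True
        by (auto simp: A_def B_def of_rat_less)
      then obtain M where M: "M \<subseteq> range \<sigma>" "infinite M" "settles A B M {\<phi>. norm \<phi> \<le> 1}"
        by (auto simp: unsettled_def)
      define \<rho> where "\<rho> = (\<lambda>n. inv \<sigma> (enumerate M n))"
      have \<sigma>\<rho>: "\<sigma> (\<rho> n) = enumerate M n" for n
        unfolding \<rho>_def using M enumerate_in_set[of M n] by (intro f_inv_into_f) auto
      have "strict_mono \<rho>"
      proof (rule strict_monoI_Suc)
        fix n have "\<sigma> (\<rho> n) < \<sigma> (\<rho> (Suc n))" using M(2) by (simp add: \<sigma>\<rho> enumerate_step)
        then show "\<rho> n < \<rho> (Suc n)" using \<sigma> strict_mono_less by blast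
      qed
      moreover have "range (\<sigma> \<circ> \<rho>) = M"
        using range_enumerate[OF M(2)] by (simp add: \<sigma>\<rho> o_def)
      then have "Q k (\<sigma> \<circ> \<rho>)"
        using settles_subseq_eventually[of A B "\<sigma> \<circ> \<rho>" "{\<phi>. norm \<phi> \<le> 1}"] M(3)
          strict_mono_o[OF \<sigma> \<open>strict_mono \<rho>\<close>]
        by (simp add: Q_def A_def B_def not_less)
      ultimately show ?thesis by blast
    qed
  qed
  have Q_diag: "Q k diagseq" for k
  proof -
    \<comment> \<open>The diagonal sequence is a subsequence of the one built for \<open>k\<close>
      only after an initial segment, which eventual statements ignore.\<close>
    have "Q k (diagseq \<circ> ((+) (Suc k)))"
    proof (rule diagseq_holds)
      fix \<rho> \<sigma> :: "nat \<Rightarrow> nat" and n assume "strict_mono \<rho>" "Q n \<sigma>"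
      have "\<forall>\<^sub>F n in sequentially. R (\<sigma> (\<rho> n))"
        if "\<forall>\<^sub>F n in sequentially. R (\<sigma> n)" for R
        using eventually_subseq[OF \<open>strict_mono \<rho>\<close> that] .
      note sub = this[of "\<lambda>m. blinfun_apply _ (x m) \<le> _"] this[of "\<lambda>m. _ \<le> blinfun_apply _ (x m)"]
      show "Q n (\<sigma> \<circ> \<rho>)"
        using \<open>Q n \<sigma>\<close> unfolding Q_def o_def by (blast intro: sub)
    qed
    moreover define D where "D = diagseq"
    moreover have "(\<forall>\<^sub>F n in sequentially. blinfun_apply \<phi> (x (D (Suc (k + n)))) \<le> c)
        \<longleftrightarrow> (\<forall>\<^sub>F n in sequentially. blinfun_apply \<phi> (x (D n)) \<le> c)"
      and "(\<forall>\<^sub>F n in sequentially. c \<le> blinfun_apply \<phi> (x (D (Suc (k + n)))))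
        \<longleftrightarrow> (\<forall>\<^sub>F n in sequentially. c \<le> blinfun_apply \<phi> (x (D n)))" for \<phi> :: "'a \<Rightarrow>\<^sub>L real" and c
      using eventually_sequentially_seg[of "\<lambda>n. blinfun_apply \<phi> (x (D n)) \<le> c" "Suc k"]
        eventually_sequentially_seg[of "\<lambda>n. c \<le> blinfun_apply \<phi> (x (D n))" "Suc k"]
      by (simp_all add: add.commute)
    ultimately show ?thesis
      by (simp add: Q_def o_def)
  qed
  have conv: "convergent (\<lambda>k. blinfun_apply \<phi> (x (diagseq k)))"
    if \<phi>: "norm \<phi> \<le> 1" for \<phi> :: "'a \<Rightarrow>\<^sub>L real"
  proof (rule convergent_if_no_oscillation)
    have "norm (blinfun_apply \<phi> (x n)) \<le> 1" for n
      using norm_blinfun[of \<phi> "x n"] mult_mono[OF \<phi> x[of n]] by simp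
    then show "bounded (range (\<lambda>k. blinfun_apply \<phi> (x (diagseq k))))"
      by (auto simp: bounded_iff)
    fix p q :: rat assume "p < q"
    then show "(\<forall>\<^sub>F n in sequentially. blinfun_apply \<phi> (x (diagseq n)) \<le> of_rat q) \<or>
        (\<forall>\<^sub>F n in sequentially. of_rat p \<le> blinfun_apply \<phi> (x (diagseq n)))"
      using Q_diag[of "to_nat (p, q)"] \<phi> by (simp add: Q_def r_def s_def)
  qed
  show thesis
  proof (rule that[OF subseq_diagseq])
    fix \<phi> :: "'a \<Rightarrow>\<^sub>L real"
    \<comment> \<open>Scales \<open>\<phi>\<close> into the unit ball; adding 1 covers
      \<open>\<phi> = 0\<close>.\<close>
    have "0 < norm \<phi> + 1" by (simp add: add_nonneg_pos)
    then have "convergent (\<lambda>k. (norm \<phi> + 1) * blinfun_apply ((1 / (norm \<phi> + 1)) *\<^sub>R \<phi>) (x (diagseq k)))"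
      by (intro convergent_mult convergent_const conv) simp
    then show "convergent (\<lambda>k. blinfun_apply \<phi> (x (diagseq k)))"
      using \<open>0 < norm \<phi> + 1\<close> by (simp add: blinfun.scaleR_left)
  qed
qed

subsection \<open>Oscillation quantities\<close>

lemma ca_nonneg: "bounded (range u) \<Longrightarrow> 0 \<le> ca u"
  unfolding ca_def
  by (intro cINF_greatest diameter_ge_0) (auto intro: bounded_subset)

lemma ca_le:
  assumes "bounded (range u)" "\<And>k l. n \<le> k \<Longrightarrow> n \<le> l \<Longrightarrow> dist (u k) (u l) \<le> r"
  shows "ca u \<le> r"
proof -
  have bdd: "bdd_below (range (\<lambda>n. diameter (u ` {n..})))"
    using assms(1) by (intro bdd_belowI2[where m = 0] diameter_ge_0) (auto intro: bounded_subset)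
  have "ca u \<le> diameter (u ` {n..})"
    unfolding ca_def using bdd by (intro cINF_lower) auto
  also have "\<dots> \<le> r"
    using assms(2) by (intro diameter_le) (auto simp: dist_norm)
  finally show ?thesis .
qed

lemma ca_lessD:
  assumes "bounded (range u)" "ca u < r"
  obtains n where "\<And>k l. n \<le> k \<Longrightarrow> n \<le> l \<Longrightarrow> dist (u k) (u l) < r"
proof -
  obtain n where n: "diameter (u ` {n..}) < r"
    using cInf_lessD[of "range (\<lambda>n. diameter (u ` {n..}))" r] assms(2) by (auto simp: ca_def)
  have "dist (u k) (u l) \<le> diameter (u ` {n..})" if "n \<le> k" "n \<le> l" for k l
    using that assms(1) by (intro diameter_bounded_bound) (auto intro: bounded_subset)
  then show thesis using n that by (meson le_less_trans)
qed

lemma qdelta_eq: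
  "qdelta (x :: nat \<Rightarrow> 'z::real_normed_vector) =
    (SUP f\<in>{f :: 'z \<Rightarrow>\<^sub>L real. norm f \<le> 1}. ca (\<lambda>k. blinfun_apply f (x k)))"
  by (simp add: qdelta_def ca_def)

lemma bounded_blinfun_comp:
  "bounded (range x) \<Longrightarrow> bounded (range (\<lambda>k. blinfun_apply f (x k)))"
  using bounded_linear_image[OF _ blinfun.bounded_linear_right, of "range x" f]
  by (simp add: image_image)

lemma ca_le_qdelta:
  fixes f :: "'a::real_normed_vector \<Rightarrow>\<^sub>L real"
  assumes x: "bounded (range x)" and f: "norm f \<le> 1"
  shows "ca (\<lambda>k. blinfun_apply f (x k)) \<le> qdelta x"
proof -
  obtain M where M: "\<And>k. norm (x k) \<le> M"
    using x by (auto simp: bounded_iff)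
  \<comment> \<open>A bound uniform over the dual ball, so that the real supremum defining
    \<open>qdelta\<close> is a genuine upper bound.\<close>
  have "ca (\<lambda>k. blinfun_apply g (x k)) \<le> 2 * M" if g: "norm g \<le> 1" for g :: "'a \<Rightarrow>\<^sub>L real"
  proof (rule ca_le[OF bounded_blinfun_comp[OF x], of 0])
    fix k l
    have "norm (blinfun_apply g (x k)) \<le> M" for k
      using norm_blinfun[of g "x k"] mult_mono[OF g M[of k]] by simp
    from this[of k] this[of l] show "dist (blinfun_apply g (x k)) (blinfun_apply g (x l)) \<le> 2 * M"
      by (simp add: dist_real_def)
  qed
  then show ?thesis
    unfolding qdelta_eq using f by (intro cSUP_upper bdd_aboveI2[where M = "2 * M"]) auto
qed

lemma qdelta_nonneg:
  assumes "bounded (range x)" shows "0 \<le> qdelta x"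
proof -
  have "0 \<le> ca (\<lambda>k. blinfun_apply 0 (x k) :: real)"
    using bounded_blinfun_comp[OF assms] by (rule ca_nonneg)
  also have "\<dots> \<le> qdelta x"
    using assms by (rule ca_le_qdelta) simp
  finally show ?thesis .
qed

lemma qdelta_nonpos_if_weakly_null:
  fixes x :: "nat \<Rightarrow> 'a::real_normed_vector"
  assumes x: "bounded (range x)" and null: "\<And>f :: 'a \<Rightarrow>\<^sub>L real. (\<lambda>k. blinfun_apply f (x k)) \<longlonglongrightarrow> 0"
  shows "qdelta x \<le> 0"
  unfolding qdelta_eq
proof (rule cSUP_least)
  show "{f::'a \<Rightarrow>\<^sub>L real. norm f \<le> 1} \<noteq> {}" by (auto intro: exI[of _ 0])
  fix f :: "'a \<Rightarrow>\<^sub>L real"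
  show "ca (\<lambda>k. blinfun_apply f (x k)) \<le> 0"
  proof (rule field_le_epsilon)
    fix e :: real assume "0 < e"
    then obtain n where n: "\<And>k. n \<le> k \<Longrightarrow> \<bar>blinfun_apply f (x k)\<bar> < e / 2"
      using LIMSEQ_D[OF null[of f], of "e / 2"] by auto
    show "ca (\<lambda>k. blinfun_apply f (x k)) \<le> 0 + e"
    proof (rule ca_le[OF bounded_blinfun_comp[OF x]])
      fix k l assume "n \<le> k" "n \<le> l"
      then show "dist (blinfun_apply f (x k)) (blinfun_apply f (x l)) \<le> 0 + e"
        using n[of k] n[of l] by (simp add: dist_real_def)
    qed
  qed
qed

text \<open>The contribution of one fixed set \<open>L\<close> to the supremum
  \<open>ca_rho\<close>.\<close>

definition unif_osc :: "('a::real_normed_vector) set \<Rightarrow> (nat \<Rightarrow> ('a \<Rightarrow>\<^sub>L real)) \<Rightarrow> real" where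
  "unif_osc L x = (INF n. SUP kl\<in>{n..} \<times> {n..}. SUP y\<in>L. \<bar>blinfun_apply (x (fst kl) - x (snd kl)) y\<bar>)"

context
  fixes L :: "'a::real_normed_vector set" and x :: "nat \<Rightarrow> ('a \<Rightarrow>\<^sub>L real)"
  assumes L: "L \<noteq> {}" "L \<subseteq> cball 0 1" and x: "bounded (range x)"
begin

lemma abs_diff_apply_le:
  assumes "y \<in> L" shows "\<bar>blinfun_apply (x k - x l) y\<bar> \<le> dist (x k) (x l)"
proof -
  have "norm y \<le> 1" using assms L(2) by auto
  then have "norm (x k - x l) * norm y \<le> norm (x k - x l)" by (simp add: mult_left_le)
  then show ?thesis
    using norm_blinfun[of "x k - x l" y] by (simp add: dist_norm)
qed

lemma bdd_above_diff_apply: "bdd_above ((\<lambda>y. \<bar>blinfun_apply (x k - x l) y\<bar>) ` L)"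
  using abs_diff_apply_le by (auto intro!: bdd_aboveI2)

lemma bdd_above_SUP_diff_apply:
  "bdd_above ((\<lambda>kl. SUP y\<in>L. \<bar>blinfun_apply (x (fst kl) - x (snd kl)) y\<bar>) ` S)"
proof (rule bdd_aboveI2)
  fix kl assume "kl \<in> S"
  have "dist (x (fst kl)) (x (snd kl)) \<le> diameter (range x)"
    using x by (intro diameter_bounded_bound) auto
  then show "(SUP y\<in>L. \<bar>blinfun_apply (x (fst kl) - x (snd kl)) y\<bar>) \<le> diameter (range x)"
    using abs_diff_apply_le[of _ "fst kl" "snd kl"] L(1) by (intro cSUP_least) (auto intro: order_trans)
qed

lemma le_SUP_diff_apply:
  assumes "y \<in> L" "n \<le> k" "n \<le> l"
  shows "\<bar>blinfun_apply (x k - x l) y\<bar>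
    \<le> (SUP kl\<in>{n..} \<times> {n..}. SUP y\<in>L. \<bar>blinfun_apply (x (fst kl) - x (snd kl)) y\<bar>)"
proof -
  have "\<bar>blinfun_apply (x k - x l) y\<bar> \<le> (SUP y\<in>L. \<bar>blinfun_apply (x k - x l) y\<bar>)"
    using assms(1) bdd_above_diff_apply by (rule cSUP_upper)
  also have "\<dots> \<le> (SUP kl\<in>{n..} \<times> {n..}. SUP y\<in>L. \<bar>blinfun_apply (x (fst kl) - x (snd kl)) y\<bar>)"
    using assms(2,3) by (intro cSUP_upper2[where x = "(k, l)"] bdd_above_SUP_diff_apply) auto
  finally show ?thesis .
qed

lemma le_unif_osc:
  assumes "\<And>n. \<exists>k\<ge>n. \<exists>l\<ge>n. \<exists>y\<in>L. r \<le> \<bar>blinfun_apply (x k - x l) y\<bar>"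
  shows "r \<le> unif_osc L x"
  unfolding unif_osc_def
proof (rule cINF_greatest)
  fix n
  obtain k l y where "n \<le> k" "n \<le> l" "y \<in> L" "r \<le> \<bar>blinfun_apply (x k - x l) y\<bar>"
    using assms by blast
  then show "r \<le> (SUP kl\<in>{n..} \<times> {n..}. SUP y\<in>L. \<bar>blinfun_apply (x (fst kl) - x (snd kl)) y\<bar>)"
    using le_SUP_diff_apply[of y n k l] by linarith
qed simp

lemma unif_osc_le_ca: "unif_osc L x \<le> ca x"
proof (rule field_le_epsilon)
  fix e :: real assume "0 < e"
  then obtain n where n: "\<And>k l. n \<le> k \<Longrightarrow> n \<le> l \<Longrightarrow> dist (x k) (x l) < ca x + e"
    using ca_lessD[OF x, of "ca x + e"] by auto
  \<comment> \<open>A point of \<open>L\<close>, used with equal indices, shows that 0 is a lower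
    bound of the infimum.\<close>
  obtain y where y: "y \<in> L" using L(1) by blast
  have bdd: "bdd_below (range (\<lambda>n. SUP kl\<in>{n..} \<times> {n..}. SUP y\<in>L. \<bar>blinfun_apply (x (fst kl) - x (snd kl)) y\<bar>))"
    using le_SUP_diff_apply[OF y order_refl order_refl] by (intro bdd_belowI2[where m = 0]) auto
  have "unif_osc L x \<le> (SUP kl\<in>{n..} \<times> {n..}. SUP y\<in>L. \<bar>blinfun_apply (x (fst kl) - x (snd kl)) y\<bar>)"
    unfolding unif_osc_def using bdd by (intro cINF_lower) auto
  also have "\<dots> \<le> ca x + e"
  proof (intro cSUP_least)
    fix kl y assume kl: "kl \<in> {n..} \<times> {n..}" and "y \<in> L"
    then have "\<bar>blinfun_apply (x (fst kl) - x (snd kl)) y\<bar> \<le> dist (x (fst kl)) (x (snd kl))"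
      by (intro abs_diff_apply_le)
    also have "\<dots> \<le> ca x + e" using n[of "fst kl" "snd kl"] kl by auto
    finally show "\<bar>blinfun_apply (x (fst kl) - x (snd kl)) y\<bar> \<le> ca x + e" .
  qed (use L(1) in auto)
  finally show "unif_osc L x \<le> ca x + e" .
qed

end

section \<open>Weakly compact sets and the weak topology\<close>

lemma topspace_weak_top: "topspace (weak_top :: 'a::real_normed_vector topology) = UNIV"
proof -
  have "(UNIV :: 'a set) \<in> {{y. blinfun_apply f y \<in> U} | (f::'a \<Rightarrow>\<^sub>L real) U. open U}"
    by (auto intro!: exI[of _ UNIV])
  then show ?thesis unfolding weak_top_def topology_generated_by_topspace by blast
qed

lemma ca_rho_eq:
  "ca_rho x = (SUP L\<in>{L. L \<noteq> {} \<and> L \<subseteq> cball 0 1 \<and> compactin weak_top L}. unif_osc L x)"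
  by (simp add: ca_rho_def unif_osc_def)

lemma unif_osc_le_ca_rho:
  assumes "bounded (range x)" "L \<noteq> {}" "L \<subseteq> cball 0 1" "compactin weak_top L"
  shows "unif_osc L x \<le> ca_rho x"
  unfolding ca_rho_eq
  using assms unif_osc_le_ca by (intro cSUP_upper bdd_aboveI2[where M = "ca x"]) auto

lemma ca_rho_le_ca:
  fixes x :: "nat \<Rightarrow> ('a::real_normed_vector \<Rightarrow>\<^sub>L real)"
  assumes "bounded (range x)"
  shows "ca_rho x \<le> ca x"
  unfolding ca_rho_eq
proof (rule cSUP_least)
  have "{0::'a} \<in> {L. L \<noteq> {} \<and> L \<subseteq> cball 0 1 \<and> compactin weak_top L}"
    by (simp add: compactin_sing topspace_weak_top)
  then show "{L::'a set. L \<noteq> {} \<and> L \<subseteq> cball 0 1 \<and> compactin weak_top L} \<noteq> {}" by blast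
qed (use assms unif_osc_le_ca in auto)

text \<open>Convergence has to be checked on subbasic sets only, by induction on the generation of
  the topology. It makes a weakly null sequence together with 0 a weakly compact set.\<close>

lemma limitin_weak_top:
  fixes y :: "nat \<Rightarrow> 'a::real_normed_vector"
  assumes "\<And>f :: 'a \<Rightarrow>\<^sub>L real. (\<lambda>k. blinfun_apply f (y k)) \<longlonglongrightarrow> blinfun_apply f l"
  shows "limitin weak_top y l sequentially"
proof -
  have "\<forall>\<^sub>F k in sequentially. y k \<in> U"
    if "generate_topology_on {{y. blinfun_apply f y \<in> U} | (f::'a \<Rightarrow>\<^sub>L real) U. open U} U" "l \<in> U" for U
    using that
  proof (induction rule: generate_topology_on.induct)
    case Empty
    then show ?case by simp
  next
    case (Int a b)
    then show ?case by (auto intro: eventually_conj)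
  next
    case (UN K)
    then obtain k where k: "k \<in> K" "l \<in> k" by blast
    then have "\<forall>\<^sub>F j in sequentially. y j \<in> k" using UN.IH by blast
    then show ?case by (rule eventually_mono) (use k in blast)
  next
    case (Basis s)
    then obtain f :: "'a \<Rightarrow>\<^sub>L real" and U where s: "s = {y. blinfun_apply f y \<in> U}" "open U" by blast
    then show ?case
      using topological_tendstoD[OF assms[of f], of U] Basis.prems by simp
  qed
  then show ?thesis
    unfolding limitin_def topspace_weak_top by (simp add: weak_top_def openin_topology_generated_by_iff)
qed

text \<open>A point where the norm bound \<open>c\<close> fails is normalised and multiplied by a
  sign, so that the value itself and not just its modulus exceeds \<open>c\<close>.\<close>

lemma norm_blinfun_exceeds:
  fixes f :: "'a::real_normed_vector \<Rightarrow>\<^sub>L real"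
  assumes c: "0 \<le> c" "c < norm f"
  obtains x where "norm x \<le> 1" "c < blinfun_apply f x"
proof -
  have "\<exists>x. c * norm x < norm (blinfun_apply f x)"
    using norm_blinfun_bound[of c f] c by (meson not_le)
  then obtain x where x: "c * norm x < \<bar>blinfun_apply f x\<bar>" by auto
  then have x0: "x \<noteq> 0" by (auto simp: blinfun.zero_right)
  define y where "y = (sgn (blinfun_apply f x) / norm x) *\<^sub>R x"
  have "norm y \<le> 1"
    using x0 by (simp add: y_def abs_sgn_eq)
  moreover have "blinfun_apply f y = \<bar>blinfun_apply f x\<bar> / norm x"
    by (simp add: y_def blinfun.scaleR_right abs_sgn mult.commute)
  then have "c < blinfun_apply f y"
    using x x0 by (simp add: pos_less_divide_eq)
  ultimately show thesis using that by blast
qed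

subsection \<open>Schur and Dunford--Pettis properties\<close>

lemma C_Schur_imp_direct_qDP:
  fixes C :: real
  assumes C: "0 \<le> C" and Schur: "C_Schur C TYPE('a::real_normed_vector \<Rightarrow>\<^sub>L real)"
  shows "direct_qDP TYPE('a)"
  unfolding direct_qDP_def
proof (intro exI conjI allI impI)
  \<comment> \<open>\<open>C\<close> may be 0, but \<open>direct_qDP\<close> asks for a positive
    constant.\<close>
  show "0 < C + 1" using C by simp
  fix x :: "nat \<Rightarrow> ('a \<Rightarrow>\<^sub>L real)" assume x: "bounded (range x)"
  have "ca_rho x \<le> ca x" using x by (rule ca_rho_le_ca)
  also have "\<dots> \<le> C * qdelta x" using Schur x by (auto simp: C_Schur_def)
  also have "\<dots> \<le> (C + 1) * qdelta x" using qdelta_nonneg[OF x] by (intro mult_right_mono) auto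
  finally show "ca_rho x \<le> (C + 1) * qdelta x" .
qed

lemma direct_qDP_imp_C_Schur:
  assumes K: "0 < K" and qDP: "\<And>x :: nat \<Rightarrow> ('a::banach \<Rightarrow>\<^sub>L real). bounded (range x) \<Longrightarrow> ca_rho x \<le> K * qdelta x"
    and no_l1: "\<not> contains_l1 TYPE('a)"
  shows "C_Schur (2 * K + 1) TYPE('a \<Rightarrow>\<^sub>L real)"
  unfolding C_Schur_def
proof (intro allI impI)
  fix f :: "nat \<Rightarrow> ('a \<Rightarrow>\<^sub>L real)" assume f: "bounded (range f)"
  define q where "q = qdelta f"
  have q: "0 \<le> q" using qdelta_nonneg[OF f] by (simp add: q_def)
  have "ca f \<le> (2 * K + 1) * q"
  proof (rule ccontr)
    assume "\<not> ca f \<le> (2 * K + 1) * q"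
    then obtain c where c: "(2 * K + 1) * q < c" "c < ca f" using dense not_le by blast
    have "0 \<le> (2 * K + 1) * q" using K q by simp
    then have c0: "0 \<le> c" using c by simp
    have "\<exists>k l z. n \<le> k \<and> n \<le> l \<and> norm z \<le> 1 \<and> c < blinfun_apply (f k - f l) z" for n
    proof -
      obtain k l where kl: "n \<le> k" "n \<le> l" "c < norm (f k - f l)"
        using ca_le[OF f, of n c] c(2) by (force simp: dist_norm)
      then show ?thesis using norm_blinfun_exceeds[OF c0 kl(3)] by metis
    qed
    then obtain k l x where kl: "\<And>n. n \<le> k n" "\<And>n. n \<le> l n" and x: "\<And>n. norm (x n) \<le> 1"
      and cx: "\<And>n. c < blinfun_apply (f (k n) - f (l n)) (x n)" by metis
    define g where "g = (\<lambda>n. f (k n) - f (l n))"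
    \<comment> \<open>Half the gap: the estimate reached at the end,
      \<open>c - e \<le> (2 * K + 1) * q\<close>, contradicts
      \<open>c - 2 * e = (2 * K + 1) * q\<close>.\<close>
    define e where "e = (c - (2 * K + 1) * q) / 2"
    have e: "0 < e" using c by (simp add: e_def)
    obtain \<sigma> :: "nat \<Rightarrow> nat" where \<sigma>: "strict_mono \<sigma>"
      "\<And>\<phi> :: 'a \<Rightarrow>\<^sub>L real. convergent (\<lambda>k. blinfun_apply \<phi> (x (\<sigma> k)))"
      using Rosenthal_l1[of x, OF x no_l1] by blast
    \<comment> \<open>Evaluation at \<open>x m\<close> is a functional of norm at most 1 on the
      dual, so \<open>q\<close> controls its eventual oscillation along \<open>f\<close>;
      \<open>g n\<close> is a difference of terms with indices at least \<open>n\<close>.\<close>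
    have small: "\<exists>N. \<forall>n\<ge>N. \<bar>blinfun_apply (g n) (x m)\<bar> < q + e" for m
    proof -
      define ev :: "('a \<Rightarrow>\<^sub>L real) \<Rightarrow>\<^sub>L real" where "ev = Blinfun (\<lambda>\<phi>. blinfun_apply \<phi> (x m))"
      have ev: "blinfun_apply ev \<phi> = blinfun_apply \<phi> (x m)" for \<phi>
        by (simp add: ev_def bounded_linear_Blinfun_apply blinfun.bounded_linear_left)
      have "norm ev \<le> 1"
      proof (rule norm_blinfun_bound)
        fix \<phi> :: "'a \<Rightarrow>\<^sub>L real"
        show "norm (blinfun_apply ev \<phi>) \<le> 1 * norm \<phi>"
          using norm_blinfun[of \<phi> "x m"] mult_left_mono[OF x[of m], of "norm \<phi>"] by (simp add: ev)
      qed simp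
      from ca_le_qdelta[OF f this] have "ca (\<lambda>n. blinfun_apply ev (f n)) < q + e"
        using e by (simp add: q_def)
      then obtain N where N: "\<And>k l. N \<le> k \<Longrightarrow> N \<le> l \<Longrightarrow> dist (blinfun_apply ev (f k)) (blinfun_apply ev (f l)) < q + e"
        using ca_lessD[OF bounded_blinfun_comp[OF f]] by blast
      have "\<bar>blinfun_apply (g n) (x m)\<bar> < q + e" if "N \<le> n" for n
        using N[of "k n" "l n"] kl[of n] that by (simp add: g_def ev blinfun.diff_left dist_real_def)
      then show ?thesis by blast
    qed
    have "\<exists>\<tau>::nat \<Rightarrow> nat. \<forall>j. True \<and> (\<tau> j < \<tau> (Suc j) \<and>
        \<bar>blinfun_apply (g (\<sigma> (\<tau> (Suc j)))) (x (\<sigma> (\<tau> j)))\<bar> < q + e)"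
    proof (rule dependent_nat_choice)
      fix i :: nat
      obtain N where N: "\<And>n. N \<le> n \<Longrightarrow> \<bar>blinfun_apply (g n) (x (\<sigma> i))\<bar> < q + e"
        using small by blast
      \<comment> \<open>The maximum secures both \<open>i < i'\<close> and, since
        \<open>\<sigma>\<close> dominates the identity, an index beyond \<open>N\<close>.\<close>
      have "N \<le> \<sigma> (max N (Suc i))"
        using seq_suble[OF \<sigma>(1), of "max N (Suc i)"] by simp
      then show "\<exists>i'. True \<and> (i < i' \<and> \<bar>blinfun_apply (g (\<sigma> i')) (x (\<sigma> i))\<bar> < q + e)"
        using N by (intro exI[of _ "max N (Suc i)"]) auto
    qed simp
    then obtain \<tau> :: "nat \<Rightarrow> nat" where \<tau>: "\<And>j. \<tau> j < \<tau> (Suc j)"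
      "\<And>j. \<bar>blinfun_apply (g (\<sigma> (\<tau> (Suc j)))) (x (\<sigma> (\<tau> j)))\<bar> < q + e" by blast
    have \<tau>_mono: "strict_mono \<tau>" using \<tau>(1) by (rule strict_monoI_Suc)
    \<comment> \<open>Consecutive differences of a weakly Cauchy sequence are weakly null; the
      factor 1/2 keeps them in the unit ball.\<close>
    define y where "y = (\<lambda>j. (1/2) *\<^sub>R (x (\<sigma> (\<tau> (Suc j))) - x (\<sigma> (\<tau> j))))"
    have y_le: "norm (y j) \<le> 1" for j
      using norm_triangle_ineq4[of "x (\<sigma> (\<tau> (Suc j)))" "x (\<sigma> (\<tau> j))"] x[of "\<sigma> (\<tau> (Suc j))"] x[of "\<sigma> (\<tau> j)"]
      by (simp add: y_def)
    have "(\<lambda>j. blinfun_apply \<phi> (y j)) \<longlonglongrightarrow> 0" for \<phi> :: "'a \<Rightarrow>\<^sub>L real"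
    proof -
      obtain a where "(\<lambda>i. blinfun_apply \<phi> (x (\<sigma> i))) \<longlonglongrightarrow> a"
        using \<sigma>(2) by (auto simp: convergent_def)
      then have a: "(\<lambda>j. blinfun_apply \<phi> (x (\<sigma> (\<tau> j)))) \<longlonglongrightarrow> a"
        using LIMSEQ_subseq_LIMSEQ[OF _ \<tau>_mono] by (auto simp: o_def)
      have "(\<lambda>j. 1 / 2 * (blinfun_apply \<phi> (x (\<sigma> (\<tau> (Suc j)))) - blinfun_apply \<phi> (x (\<sigma> (\<tau> j)))))
          \<longlonglongrightarrow> 1 / 2 * (a - a)"
        by (intro tendsto_mult_left tendsto_diff a LIMSEQ_Suc[OF a])
      then show ?thesis
        by (simp add: y_def blinfun.scaleR_right blinfun.diff_right)
    qed
    then have "limitin weak_top y 0 sequentially"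
      by (intro limitin_weak_top) (simp add: blinfun.zero_right)
    then have cpt: "compactin weak_top (insert 0 (range y))"
      by (rule compactin_sequence_with_limit) (auto simp: topspace_weak_top)
    define L where "L = insert 0 (range y)"
    have L: "L \<noteq> {}" "L \<subseteq> cball 0 1" using y_le by (auto simp: L_def)
    have "(c - q - e) / 2 \<le> unif_osc L f"
    proof (rule le_unif_osc[OF L f])
      fix n
      define m where "m = \<sigma> (\<tau> (Suc n))"
      have "Suc n \<le> m"
        using seq_suble[OF strict_mono_o[OF \<sigma>(1) \<tau>_mono], of "Suc n"] by (simp add: m_def)
      then have "n \<le> k m" "n \<le> l m" using kl[of m] by auto
      moreover have cxg: "c < blinfun_apply (g m) (x m)" using cx[of m] by (simp add: g_def)
      \<comment> \<open>\<open>g m\<close> exceeds \<open>c\<close> at \<open>x m\<close> and is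
        below \<open>q + e\<close> at the preceding point of the subsequence.\<close>
      have "(c - q - e) / 2 \<le> blinfun_apply (g m) (y n)"
        using cxg \<tau>(2)[of n]
        by (simp add: y_def blinfun.scaleR_right blinfun.diff_right flip: m_def)
      then have "(c - q - e) / 2 \<le> \<bar>blinfun_apply (f (k m) - f (l m)) (y n)\<bar>"
        by (simp add: g_def)
      moreover have "y n \<in> L" by (simp add: L_def)
      ultimately show "\<exists>k\<ge>n. \<exists>l\<ge>n. \<exists>y\<in>L. (c - q - e) / 2 \<le> \<bar>blinfun_apply (f k - f l) y\<bar>"
        by blast
    qed
    also have "\<dots> \<le> ca_rho f"
      using f L cpt by (intro unif_osc_le_ca_rho) (auto simp: L_def)
    also have "\<dots> \<le> K * q" using qDP[OF f] by (simp add: q_def)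
    finally have "c - e \<le> (2 * K + 1) * q" by (simp add: algebra_simps)
    then show False using e by (simp add: e_def field_simps)
  qed
  then show "ca f \<le> (2 * K + 1) * qdelta f" by (simp add: q_def)
qed

subsection \<open>Spaces containing a copy of \<open>\<ell>\<^sub>1\<close>\<close>

text \<open>Rademacher functions: a subset \<open>A\<close> of \<open>{..<N}\<close> encodes a
  choice of \<open>N\<close> signs, and averaging over \<open>Pow {..<N}\<close> is the
  expectation.\<close>

definition rad :: "nat set \<Rightarrow> nat \<Rightarrow> real" where
  "rad A n = (if n \<in> A then 1 else - 1)"

lemma rad_mult_self: "rad A n * rad A n = 1"
  by (simp add: rad_def)

text \<open>For distinct indices, toggling the membership of \<open>n\<close> is an involution of
  the power set that changes the sign of each term.\<close>

lemma sum_rad_orthogonal: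
  assumes "n < N"
  shows "(\<Sum>A\<in>Pow {..<N}. rad A n * rad A m) = (if n = m then 2 ^ N else 0)"
proof (cases "n = m")
  case True
  then show ?thesis by (simp add: rad_mult_self card_Pow)
next
  case False
  define h where "h = (\<lambda>A. if n \<in> A then A - {n} else insert n A)"
  have "(\<Sum>A\<in>Pow {..<N}. rad A n * rad A m) = (\<Sum>A\<in>Pow {..<N}. - (rad A n * rad A m))"
    by (rule sum.reindex_bij_witness[of _ h h])
      (use assms False in \<open>auto simp: h_def rad_def\<close>)
  then show ?thesis using False by (simp add: sum_negf)
qed

lemma sum_rad_second_moment:
  "(\<Sum>A\<in>Pow {..<N}. (\<Sum>n<N. s n * rad A n)\<^sup>2) = 2 ^ N * (\<Sum>n<N. (s n)\<^sup>2)"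
proof -
  have "(\<Sum>A\<in>Pow {..<N}. (\<Sum>n<N. s n * rad A n)\<^sup>2)
      = (\<Sum>A\<in>Pow {..<N}. \<Sum>n<N. \<Sum>m<N. s n * s m * (rad A n * rad A m))"
    by (simp add: power2_eq_square sum_product algebra_simps)
  also have "\<dots> = (\<Sum>n<N. \<Sum>m<N. s n * s m * (\<Sum>A\<in>Pow {..<N}. rad A n * rad A m))"
    by (subst sum.swap, rule sum.cong[OF refl], subst sum.swap) (simp add: sum_distrib_left)
  also have "\<dots> = (\<Sum>n<N. s n * s n * 2 ^ N)"
    by (rule sum.cong[OF refl]) (simp add: sum_rad_orthogonal if_distrib sum.delta' cong: if_cong)
  finally show ?thesis by (simp add: power2_eq_square sum_distrib_left mult.commute)
qed

text \<open>The upper half of Khinchine's inequality, by Cauchy-Schwarz from the second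
  moment.\<close>

lemma sum_rad_first_moment:
  "(\<Sum>A\<in>Pow {..<N}. \<bar>\<Sum>n<N. s n * rad A n\<bar>) \<le> 2 ^ N * sqrt (\<Sum>n<N. (s n)\<^sup>2)"
proof (rule power2_le_imp_le)
  have "(\<Sum>A\<in>Pow {..<N}. \<bar>\<Sum>n<N. s n * rad A n\<bar>)\<^sup>2
      \<le> (\<Sum>A\<in>Pow {..<N}. \<bar>\<Sum>n<N. s n * rad A n\<bar>\<^sup>2) * card (Pow {..<N})"
    by (rule sum_squared_le_sum_of_squares)
  also have "\<dots> = (2 ^ N * sqrt (\<Sum>n<N. (s n)\<^sup>2))\<^sup>2"
    by (simp add: sum_rad_second_moment card_Pow power_mult_distrib sum_nonneg) (simp add: power2_eq_square)
  finally show "(\<Sum>A\<in>Pow {..<N}. \<bar>\<Sum>n<N. s n * rad A n\<bar>)\<^sup>2 \<le> (2 ^ N * sqrt (\<Sum>n<N. (s n)\<^sup>2))\<^sup>2" .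
qed (simp add: sum_nonneg)

section \<open>Functionals built on a copy of l1\<close>

lemma sum_abs_le_l1norm: "a \<in> l1 \<Longrightarrow> (\<Sum>n<N. \<bar>a n\<bar>) \<le> l1norm a"
  unfolding l1norm_def by (rule sum_le_suminf) (auto simp: l1_def)

lemma l1_lincomb:
  assumes "a \<in> l1" "b \<in> l1" shows "(\<lambda>n. r * a n + s * b n) \<in> l1"
proof -
  have "summable (\<lambda>n. \<bar>r\<bar> * \<bar>a n\<bar> + \<bar>s\<bar> * \<bar>b n\<bar>)"
    using assms by (intro summable_add summable_mult) (auto simp: l1_def)
  then have "summable (\<lambda>n. \<bar>r * a n + s * b n\<bar>)"
    by (rule summable_comparison_test[rotated])
      (auto intro!: exI[of _ 0] abs_triangle_ineq[THEN order_trans] simp: abs_mult)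
  then show ?thesis by (simp add: l1_def)
qed

lemma unit_in_l1: "(\<lambda>k. if k = m then 1 else 0) \<in> l1"
  and l1norm_unit: "l1norm (\<lambda>k. if k = m then 1 else 0) = 1"
proof -
  have "(\<lambda>k. \<bar>if k = m then 1 else 0 :: real\<bar>) = (\<lambda>k. if k = m then 1 else 0)" by auto
  then have "(\<lambda>k. \<bar>if k = m then 1 else 0 :: real\<bar>) sums 1"
    using sums_single[of m "\<lambda>_. 1 :: real"] by simp
  then show "(\<lambda>k. if k = m then 1 else 0) \<in> l1" "l1norm (\<lambda>k. if k = m then 1 else 0) = 1"
    by (auto simp: l1_def l1norm_def sums_iff)
qed

text \<open>The lower estimate makes \<open>T\<close> injective on \<open>l1\<close>, so
  coefficients can be read off on its image. There the signed sum of the first \<open>N\<close>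
  coefficients is at most \<open>l1norm\<close>, hence at most \<open>1 / c\<close> times the norm;
  Hahn-Banach extends it. The bound is independent of \<open>N\<close> and \<open>A\<close>.\<close>

lemma ex_sign_functional:
  fixes T :: "(nat \<Rightarrow> real) \<Rightarrow> 'a::real_normed_vector"
  assumes c: "0 < c"
    and lin: "\<And>a b r s. a \<in> l1 \<Longrightarrow> b \<in> l1 \<Longrightarrow> T (\<lambda>n. r * a n + s * b n) = r *\<^sub>R T a + s *\<^sub>R T b"
    and lower: "\<And>a. a \<in> l1 \<Longrightarrow> c * l1norm a \<le> norm (T a)"
  shows "\<exists>\<phi> :: 'a \<Rightarrow>\<^sub>L real. norm \<phi> \<le> 1 / c \<and>
    (\<forall>m<N. blinfun_apply \<phi> (T (\<lambda>k. if k = m then 1 else 0)) = rad A m)"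
proof -
  have inj: "inj_on T l1"
  proof (rule inj_onI)
    fix a b assume ab: "a \<in> l1" "b \<in> l1" "T a = T b"
    define d where "d = (\<lambda>n. 1 * a n + (- 1) * b n)"
    have d: "d \<in> l1" "T d = 0"
      using ab(3) l1_lincomb[OF ab(1,2), of 1 "- 1"] lin[OF ab(1,2), of 1 "- 1"] by (simp_all add: d_def)
    have "c * l1norm d \<le> 0" using lower[OF d(1)] d(2) by simp
    then have l0: "l1norm d \<le> 0" using c by (simp add: mult_le_0_iff)
    have "\<bar>d n\<bar> \<le> 0" for n
    proof -
      have "\<bar>d n\<bar> \<le> (\<Sum>k<Suc n. \<bar>d k\<bar>)" by (simp add: sum_nonneg)
      then show ?thesis using sum_abs_le_l1norm[OF d(1), of "Suc n"] l0 by linarith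
    qed
    then show "a = b" by (auto simp: d_def)
  qed
  define coef where "coef = inv_into l1 T"
  have coef: "coef (T a) = a" if "a \<in> l1" for a
    using inj that by (simp add: coef_def)
  define f where "f = (\<lambda>x. \<Sum>n<N. rad A n * coef x n)"
  have comb: "\<exists>d\<in>l1. r *\<^sub>R T a + s *\<^sub>R T b = T d \<and> (\<forall>n. d n = r * a n + s * b n)"
    if "a \<in> l1" "b \<in> l1" for a b r s
    using lin[OF that, of r s] l1_lincomb[OF that, of r s] by (intro bexI) auto
  have f_comb: "f (r *\<^sub>R T a + s *\<^sub>R T b) = r * f (T a) + s * f (T b)"
    if ab: "a \<in> l1" "b \<in> l1" for a b r s
  proof -
    obtain d where "d \<in> l1" "r *\<^sub>R T a + s *\<^sub>R T b = T d" "\<forall>n. d n = r * a n + s * b n"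
      using comb[OF ab] by blast
    then show ?thesis
      using ab by (simp add: f_def coef algebra_simps sum.distrib sum_distrib_left)
  qed
  have sub: "subspace (T ` l1)"
  proof (rule subspaceI)
    show "0 \<in> T ` l1"
      using comb[OF unit_in_l1 unit_in_l1, of 0 0 0 0] by (auto simp: image_iff)
    show "x + y \<in> T ` l1" if "x \<in> T ` l1" "y \<in> T ` l1" for x y
    proof -
      obtain a b where "a \<in> l1" "b \<in> l1" "x = T a" "y = T b" using \<open>x \<in> _\<close> \<open>y \<in> _\<close> by blast
      then show ?thesis using comb[of a b 1 1] by auto
    qed
    show "r *\<^sub>R x \<in> T ` l1" if "x \<in> T ` l1" for x r
    proof -
      obtain a where "a \<in> l1" "x = T a" using \<open>x \<in> _\<close> by blast
      then show ?thesis using comb[of a a r 0] by auto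
    qed
  qed
  have f_le: "f x \<le> 1 / c * norm x" if "x \<in> T ` l1" for x
  proof -
    obtain a where a: "a \<in> l1" "x = T a" using \<open>x \<in> _\<close> by blast
    have "f x = (\<Sum>n<N. rad A n * a n)" using a by (simp add: f_def coef)
    also have "\<dots> \<le> (\<Sum>n<N. \<bar>a n\<bar>)"
      by (intro sum_mono) (auto simp: rad_def)
    also have "\<dots> \<le> l1norm a" using a(1) by (rule sum_abs_le_l1norm)
    also have "\<dots> \<le> 1 / c * norm x" using lower[OF a(1)] c a(2) by (simp add: field_simps)
    finally show ?thesis .
  qed
  obtain \<phi> :: "'a \<Rightarrow>\<^sub>L real" where \<phi>: "\<And>x. x \<in> T ` l1 \<Longrightarrow> blinfun_apply \<phi> x = f x" "norm \<phi> \<le> 1 / c"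
  proof (rule Hahn_Banach_norm[OF sub, of f "1 / c"])
    show "f (x + y) = f x + f y" if "x \<in> T ` l1" "y \<in> T ` l1" for x y
    proof -
      obtain a b where "a \<in> l1" "b \<in> l1" "x = T a" "y = T b" using \<open>x \<in> _\<close> \<open>y \<in> _\<close> by blast
      then show ?thesis using f_comb[of a b 1 1] by simp
    qed
    show "f (r *\<^sub>R x) = r * f x" if "x \<in> T ` l1" for x r
    proof -
      obtain a where "a \<in> l1" "x = T a" using \<open>x \<in> _\<close> by blast
      then show ?thesis using f_comb[of a a r 0] by simp
    qed
    show "0 \<le> 1 / c" using c by simp
    show "f x \<le> 1 / c * norm x" if "x \<in> T ` l1" for x using that by (rule f_le)
  qed (rule that)
  have "blinfun_apply \<phi> (T (\<lambda>k. if k = m then 1 else 0)) = rad A m" if "m < N" for m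
  proof -
    have "blinfun_apply \<phi> (T (\<lambda>k. if k = m then 1 else 0)) = (\<Sum>n<N. rad A n * (if n = m then 1 else 0))"
      using \<phi>(1)[OF imageI[OF unit_in_l1[of m]]] by (simp only: f_def coef[OF unit_in_l1])
    also have "\<dots> = (\<Sum>n<N. if n = m then rad A n else 0)" by (intro sum.cong) auto
    finally show ?thesis using that by simp
  qed
  then show ?thesis using \<phi>(2) by blast
qed

text \<open>\<open>G n\<close> is the average of \<open>rad A n *\<^sub>R \<phi> A\<close> over all
  sign patterns. Orthogonality gives biorthogonality, and after exchanging the sums the norm is at
  most \<open>c\<close> times a first Rademacher moment.\<close>

lemma ex_Rademacher_functionals:
  fixes e :: "nat \<Rightarrow> 'a::real_normed_vector" and \<phi> :: "nat set \<Rightarrow> 'a \<Rightarrow>\<^sub>L real"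
  assumes \<phi>: "\<And>A. norm (\<phi> A) \<le> c" "\<And>A m. m < N \<Longrightarrow> blinfun_apply (\<phi> A) (e m) = rad A m"
  shows "\<exists>G :: nat \<Rightarrow> 'a \<Rightarrow>\<^sub>L real.
    (\<forall>n<N. \<forall>m<N. blinfun_apply (G n) (e m) = (if n = m then 1 else 0)) \<and>
    (\<forall>s. norm (\<Sum>n<N. s n *\<^sub>R G n) \<le> c * sqrt (\<Sum>n<N. (s n)\<^sup>2))"
proof (intro exI conjI allI impI)
  define G where "G = (\<lambda>n. (1 / 2 ^ N) *\<^sub>R (\<Sum>A\<in>Pow {..<N}. rad A n *\<^sub>R \<phi> A))"
  show "blinfun_apply (G n) (e m) = (if n = m then 1 else 0)" if "n < N" "m < N" for n m
    using that sum_rad_orthogonal[of n N m]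
    by (simp add: G_def blinfun.sum_left blinfun.scaleR_left \<phi>)
  fix s :: "nat \<Rightarrow> real"
  have c: "0 \<le> c" using \<phi>(1)[of "{}"] norm_ge_zero order_trans by blast
  have "(\<Sum>n<N. s n *\<^sub>R G n) = (1 / 2 ^ N) *\<^sub>R (\<Sum>n<N. \<Sum>A\<in>Pow {..<N}. (s n * rad A n) *\<^sub>R \<phi> A)"
    by (simp add: G_def scaleR_sum_right mult_ac)
  also have "(\<Sum>n<N. \<Sum>A\<in>Pow {..<N}. (s n * rad A n) *\<^sub>R \<phi> A)
      = (\<Sum>A\<in>Pow {..<N}. (\<Sum>n<N. s n * rad A n) *\<^sub>R \<phi> A)"
    by (subst sum.swap) (simp add: scaleR_sum_left)
  finally have "norm (\<Sum>n<N. s n *\<^sub>R G n)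
      = 1 / 2 ^ N * norm (\<Sum>A\<in>Pow {..<N}. (\<Sum>n<N. s n * rad A n) *\<^sub>R \<phi> A)"
    by simp
  also have "\<dots> \<le> 1 / 2 ^ N * (\<Sum>A\<in>Pow {..<N}. \<bar>\<Sum>n<N. s n * rad A n\<bar> * c)"
    by (intro mult_left_mono order_trans[OF norm_sum] sum_mono) (auto intro!: mult_left_mono \<phi>)
  also have "\<dots> = 1 / 2 ^ N * ((\<Sum>A\<in>Pow {..<N}. \<bar>\<Sum>n<N. s n * rad A n\<bar>) * c)"
    by (simp add: sum_distrib_right)
  also have "\<dots> \<le> 1 / 2 ^ N * ((2 ^ N * sqrt (\<Sum>n<N. (s n)\<^sup>2)) * c)"
    using c by (intro mult_left_mono mult_right_mono sum_rad_first_moment) auto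
  finally show "norm (\<Sum>n<N. s n *\<^sub>R G n) \<le> c * sqrt (\<Sum>n<N. (s n)\<^sup>2)"
    by (simp add: mult.commute)
qed

text \<open>The pointwise Banach limit in \<open>N\<close> takes the place of a weak-star cluster
  point. Biorthogonality survives because the values are eventually constant, and the 2-estimate
  because it holds for all large \<open>N\<close>.\<close>

lemma ex_limit_functionals:
  fixes e :: "nat \<Rightarrow> 'a::real_normed_vector" and G :: "nat \<Rightarrow> nat \<Rightarrow> 'a \<Rightarrow>\<^sub>L real"
  assumes G_e: "\<And>N n m. n < N \<Longrightarrow> m < N \<Longrightarrow> blinfun_apply (G N n) (e m) = (if n = m then 1 else 0)"
    and G_le: "\<And>N s. norm (\<Sum>n<N. s n *\<^sub>R G N n) \<le> c * sqrt (\<Sum>n<N. (s n)\<^sup>2)"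
  obtains g :: "nat \<Rightarrow> 'a \<Rightarrow>\<^sub>L real"
  where "\<And>n m. blinfun_apply (g n) (e m) = (if n = m then 1 else 0)"
    and "\<And>N s. norm (\<Sum>n<N. s n *\<^sub>R g n) \<le> c * sqrt (\<Sum>n<N. (s n)\<^sup>2)"
proof -
  obtain \<Lambda> :: "(nat \<Rightarrow> real) \<Rightarrow> real"
    where \<Lambda>_add: "\<And>u v. Bseq u \<Longrightarrow> Bseq v \<Longrightarrow> \<Lambda> (\<lambda>n. u n + v n) = \<Lambda> u + \<Lambda> v"
      and \<Lambda>_scale: "\<And>u c. Bseq u \<Longrightarrow> \<Lambda> (\<lambda>n. c * u n) = c * \<Lambda> u"
      and \<Lambda>_abs: "\<And>u r. Bseq u \<Longrightarrow> eventually (\<lambda>n. \<bar>u n\<bar> \<le> r) sequentially \<Longrightarrow> \<bar>\<Lambda> u\<bar> \<le> r"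
      and \<Lambda>_const: "\<And>u r. Bseq u \<Longrightarrow> eventually (\<lambda>n. u n = r) sequentially \<Longrightarrow> \<Lambda> u = r"
    by (rule ex_Banach_limit_abs) blast
  define H where "H = (\<lambda>N n. if n < N then G N n else 0)"
  have sum_H: "norm (\<Sum>n<M. s n *\<^sub>R H N n) \<le> c * sqrt (\<Sum>n<M. (s n)\<^sup>2)" if "M \<le> N" for M N s
  proof -
    \<comment> \<open>Padding with zeros up to \<open>N\<close> reduces the shorter sum to
      \<open>G_le\<close>.\<close>
    define s' where "s' = (\<lambda>n. if n < M then s n else 0)"
    have "(\<Sum>n<M. s n *\<^sub>R H N n) = (\<Sum>n<N. s' n *\<^sub>R G N n)"
      using that by (intro sum.mono_neutral_cong_left) (auto simp: s'_def H_def)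
    moreover have "(\<Sum>n<M. (s n)\<^sup>2) = (\<Sum>n<N. (s' n)\<^sup>2)"
      using that by (intro sum.mono_neutral_cong_left) (auto simp: s'_def)
    ultimately show ?thesis using G_le[where N = N and s = s'] by simp
  qed
  have c: "0 \<le> c"
  proof -
    have "norm (\<Sum>n<1. 1 *\<^sub>R G 1 n) \<le> c * sqrt (\<Sum>n<(1::nat). 1\<^sup>2)" using G_le[where s = "\<lambda>_. 1"] .
    then show ?thesis using norm_ge_zero order_trans by (simp add: order_trans[OF norm_ge_zero])
  qed
  have H_le: "norm (H N n) \<le> c" for N n
  proof (cases "n < N")
    case True
    have "(\<Sum>k<Suc n. (if k = n then 1 else 0) *\<^sub>R H N k) = H N n"
      by (simp add: if_distrib[of "\<lambda>r. r *\<^sub>R _"] sum.delta cong: if_cong)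
    moreover have "(\<Sum>k<Suc n. (if k = n then 1 else 0 :: real)\<^sup>2) = 1"
      by (simp add: if_distrib[of "\<lambda>r. r\<^sup>2"] sum.delta cong: if_cong)
    ultimately show ?thesis
      using sum_H[where M = "Suc n" and N = N and s = "\<lambda>k. if k = n then 1 else 0"] True by simp
  next
    case False
    then show ?thesis using c by (simp add: H_def)
  qed
  have apply_le: "\<bar>blinfun_apply \<phi> x\<bar> \<le> r * norm x" if "norm \<phi> \<le> r" for \<phi> :: "'a \<Rightarrow>\<^sub>L real" and r x
    using norm_blinfun[of \<phi> x] mult_right_mono[OF that norm_ge_zero[of x]] by simp
  have Bseq_H: "Bseq (\<lambda>N. blinfun_apply (H N n) x)" for n x
    using apply_le[OF H_le] by (intro BseqI'[where K = "c * norm x"]) simp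
  define g where "g = (\<lambda>n. Blinfun (\<lambda>x. \<Lambda> (\<lambda>N. blinfun_apply (H N n) x)))"
  have "bounded_linear (\<lambda>x. \<Lambda> (\<lambda>N. blinfun_apply (H N n) x))" for n
  proof (rule bounded_linear_intro)
    show "\<Lambda> (\<lambda>N. blinfun_apply (H N n) (x + y)) = \<Lambda> (\<lambda>N. blinfun_apply (H N n) x) + \<Lambda> (\<lambda>N. blinfun_apply (H N n) y)" for x y
      using \<Lambda>_add[OF Bseq_H Bseq_H] by (simp add: blinfun.add_right)
    show "\<Lambda> (\<lambda>N. blinfun_apply (H N n) (r *\<^sub>R x)) = r *\<^sub>R \<Lambda> (\<lambda>N. blinfun_apply (H N n) x)" for r x
      using \<Lambda>_scale[OF Bseq_H] by (simp add: blinfun.scaleR_right)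
    show "norm (\<Lambda> (\<lambda>N. blinfun_apply (H N n) x)) \<le> norm x * c" for x
      using \<Lambda>_abs[OF Bseq_H always_eventually] apply_le[OF H_le] by (simp add: mult.commute)
  qed
  then have g: "blinfun_apply (g n) x = \<Lambda> (\<lambda>N. blinfun_apply (H N n) x)" for n x
    by (simp add: g_def bounded_linear_Blinfun_apply)
  \<comment> \<open>Boundedness is part of the induction because \<open>\<Lambda>\<close> is
    additive on bounded sequences only.\<close>
  have sum_g: "Bseq (\<lambda>N. blinfun_apply (\<Sum>n<M. s n *\<^sub>R H N n) x) \<and>
      blinfun_apply (\<Sum>n<M. s n *\<^sub>R g n) x = \<Lambda> (\<lambda>N. blinfun_apply (\<Sum>n<M. s n *\<^sub>R H N n) x)" for M s x
  proof (induction M)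
    case 0
    then show ?case using \<Lambda>_const[of "\<lambda>_. 0" 0] by simp
  next
    case (Suc M)
    have B: "Bseq (\<lambda>N. s M * blinfun_apply (H N M) x)"
      using Bseq_H by (intro Bseq_mult Bfun_const)
    have "Bseq (\<lambda>N. blinfun_apply (\<Sum>n<M. s n *\<^sub>R H N n) x + s M * blinfun_apply (H N M) x)"
      using Suc B unfolding Bseq_eq_bounded by (intro bounded_plus_comp) auto
    then show ?case
      using Suc \<Lambda>_add[OF _ B] \<Lambda>_scale[OF Bseq_H, of "s M" M x]
      by (simp add: blinfun.add_left blinfun.scaleR_left g)
  qed
  show thesis
  proof (rule that[of g])
    fix n m
    have "eventually (\<lambda>N. blinfun_apply (H N n) (e m) = (if n = m then 1 else 0)) sequentially"
      using eventually_gt_at_top[of "max n m"] by (rule eventually_mono) (simp add: H_def G_e)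
    from \<Lambda>_const[OF Bseq_H this] show "blinfun_apply (g n) (e m) = (if n = m then 1 else 0)"
      by (simp add: g)
  next
    fix M and s :: "nat \<Rightarrow> real"
    show "norm (\<Sum>n<M. s n *\<^sub>R g n) \<le> c * sqrt (\<Sum>n<M. (s n)\<^sup>2)"
    proof (rule norm_blinfun_bound)
      show "0 \<le> c * sqrt (\<Sum>n<M. (s n)\<^sup>2)" using c by (simp add: sum_nonneg)
      fix x
      have "eventually (\<lambda>N. \<bar>blinfun_apply (\<Sum>n<M. s n *\<^sub>R H N n) x\<bar> \<le> c * sqrt (\<Sum>n<M. (s n)\<^sup>2) * norm x) sequentially"
        using eventually_ge_at_top[of M] by (rule eventually_mono) (intro apply_le sum_H)
      then show "norm (blinfun_apply (\<Sum>n<M. s n *\<^sub>R g n) x) \<le> c * sqrt (\<Sum>n<M. (s n)\<^sup>2) * norm x"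
        using sum_g[where M = M and s = s and x = x] \<Lambda>_abs by simp
    qed
  qed
qed

text \<open>The coefficients \<open>s n = blinfun_apply F (g n)\<close> make the partial sum
  \<open>S\<close> of squares at most \<open>norm F * c * sqrt S\<close>. Hence the values of
  \<open>F\<close> are square summable and tend to 0.\<close>

lemma weakly_null_if_upper_2_estimate:
  fixes g :: "nat \<Rightarrow> 'b::real_normed_vector" and F :: "'b \<Rightarrow>\<^sub>L real"
  assumes g: "\<And>N s. norm (\<Sum>n<N. s n *\<^sub>R g n) \<le> c * sqrt (\<Sum>n<N. (s n)\<^sup>2)"
  shows "(\<lambda>n. blinfun_apply F (g n)) \<longlonglongrightarrow> 0"
proof -
  have "(\<Sum>n<N. (blinfun_apply F (g n))\<^sup>2) \<le> (norm F * c)\<^sup>2" for N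
  proof -
    define S where "S = (\<Sum>n<N. (blinfun_apply F (g n))\<^sup>2)"
    have S: "0 \<le> S" by (simp add: S_def sum_nonneg)
    have "S = blinfun_apply F (\<Sum>n<N. blinfun_apply F (g n) *\<^sub>R g n)"
      by (simp add: S_def blinfun.sum_right blinfun.scaleR_right power2_eq_square)
    also have "\<dots> \<le> norm F * norm (\<Sum>n<N. blinfun_apply F (g n) *\<^sub>R g n)"
      using norm_blinfun[of F "\<Sum>n<N. blinfun_apply F (g n) *\<^sub>R g n"] by simp
    also have "\<dots> \<le> norm F * (c * sqrt S)"
      unfolding S_def by (intro mult_left_mono g) auto
    finally have "sqrt S * sqrt S \<le> norm F * c * sqrt S" using S by (simp add: mult.assoc)
    then have "sqrt S \<le> norm F * c \<or> S = 0"
      using mult_right_le_imp_le[of "sqrt S" "sqrt S" "norm F * c"] S by fastforce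
    then show ?thesis
    proof
      assume "sqrt S \<le> norm F * c"
      then have "(sqrt S)\<^sup>2 \<le> (norm F * c)\<^sup>2" using S by (intro power_mono) auto
      then show ?thesis using S by (simp add: S_def)
    next
      assume "S = 0"
      then show ?thesis by (simp add: S_def)
    qed
  qed
  then have "summable (\<lambda>n. (blinfun_apply F (g n))\<^sup>2)"
    by (intro summableI_nonneg_bounded) auto
  then have "(\<lambda>n. (blinfun_apply F (g n))\<^sup>2) \<longlonglongrightarrow> 0" by (rule summable_LIMSEQ_zero)
  from tendsto_real_sqrt[OF this] show ?thesis
    by (simp add: tendsto_rabs_zero_iff)
qed

text \<open>The functionals \<open>g n\<close> are weakly null, so the Schur inequality would force
  \<open>ca g \<le> 0\<close>; but testing on \<open>e n\<close> keeps consecutive ones at distance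
  at least \<open>1 / B\<close>.\<close>

lemma contains_l1_imp_not_C_Schur:
  assumes l1: "contains_l1 TYPE('a::real_normed_vector)" and C: "0 \<le> C"
  shows "\<not> C_Schur C TYPE('a \<Rightarrow>\<^sub>L real)"
proof
  assume Schur: "C_Schur C TYPE('a \<Rightarrow>\<^sub>L real)"
  obtain T :: "(nat \<Rightarrow> real) \<Rightarrow> 'a" and c B where c: "0 < c"
    and lin: "\<And>a b r s. a \<in> l1 \<Longrightarrow> b \<in> l1 \<Longrightarrow> T (\<lambda>n. r * a n + s * b n) = r *\<^sub>R T a + s *\<^sub>R T b"
    and lower: "\<And>a. a \<in> l1 \<Longrightarrow> c * l1norm a \<le> norm (T a)"
    and upper: "\<And>a. a \<in> l1 \<Longrightarrow> norm (T a) \<le> B * l1norm a"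
    using l1 unfolding contains_l1_def by blast
  define e where "e = (\<lambda>m. T (\<lambda>k. if k = m then 1 else 0))"
  have e: "norm (e m) \<le> B" for m
    using upper[OF unit_in_l1[of m]] by (simp add: e_def l1norm_unit)
  have "\<exists>\<phi> :: 'a \<Rightarrow>\<^sub>L real. norm \<phi> \<le> 1 / c \<and> (\<forall>m<N. blinfun_apply \<phi> (e m) = rad A m)" for N A
    unfolding e_def by (rule ex_sign_functional[OF c lin lower])
  then have "\<forall>N. \<exists>\<phi>. \<forall>A. norm (\<phi> A :: 'a \<Rightarrow>\<^sub>L real) \<le> 1 / c \<and> (\<forall>m<N. blinfun_apply (\<phi> A) (e m) = rad A m)"
    by (intro allI choice)
  from choice[OF this] obtain \<phi> :: "nat \<Rightarrow> nat set \<Rightarrow> 'a \<Rightarrow>\<^sub>L real"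
    where "\<forall>N A. norm (\<phi> N A) \<le> 1 / c \<and> (\<forall>m<N. blinfun_apply (\<phi> N A) (e m) = rad A m)" ..
  then have "\<forall>N. \<exists>G :: nat \<Rightarrow> 'a \<Rightarrow>\<^sub>L real.
    (\<forall>n<N. \<forall>m<N. blinfun_apply (G n) (e m) = (if n = m then 1 else 0)) \<and>
    (\<forall>s. norm (\<Sum>n<N. s n *\<^sub>R G n) \<le> 1 / c * sqrt (\<Sum>n<N. (s n)\<^sup>2))"
    by (intro allI ex_Rademacher_functionals) auto
  from choice[OF this] obtain G :: "nat \<Rightarrow> nat \<Rightarrow> 'a \<Rightarrow>\<^sub>L real" where G: "\<forall>N.
    (\<forall>n<N. \<forall>m<N. blinfun_apply (G N n) (e m) = (if n = m then 1 else 0)) \<and>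
    (\<forall>s. norm (\<Sum>n<N. s n *\<^sub>R G N n) \<le> 1 / c * sqrt (\<Sum>n<N. (s n)\<^sup>2))" ..
  obtain g :: "nat \<Rightarrow> 'a \<Rightarrow>\<^sub>L real"
    where g_e: "\<And>n m. blinfun_apply (g n) (e m) = (if n = m then 1 else 0)"
      and g: "\<And>N s. norm (\<Sum>n<N. s n *\<^sub>R g n) \<le> 1 / c * sqrt (\<Sum>n<N. (s n)\<^sup>2)"
    by (rule ex_limit_functionals[of G e "1 / c"]) (use G in auto)
  have "norm (g n) \<le> 1 / c" for n
    using g[where N = "Suc n" and s = "\<lambda>k. if k = n then 1 else 0"]
    by (simp add: if_distrib[of "\<lambda>r. r *\<^sub>R _"] if_distrib[of "\<lambda>r. r\<^sup>2"] cong: if_cong)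
  then have bdd: "bounded (range g)" by (auto simp: bounded_iff)
  have "qdelta g \<le> 0"
    using bdd weakly_null_if_upper_2_estimate[OF g] by (rule qdelta_nonpos_if_weakly_null)
  then have "C * qdelta g \<le> 0" using C by (simp add: mult_nonneg_nonpos)
  moreover have "ca g \<le> C * qdelta g" using Schur bdd by (auto simp: C_Schur_def)
  ultimately have ca: "ca g \<le> 0" by simp
  have sep: "1 \<le> dist (g n) (g (Suc n)) * B" for n
  proof -
    have "1 = norm (blinfun_apply (g n - g (Suc n)) (e n))" by (simp add: blinfun.diff_left g_e)
    also have "\<dots> \<le> norm (g n - g (Suc n)) * norm (e n)" by (rule norm_blinfun)
    also have "\<dots> \<le> norm (g n - g (Suc n)) * B" by (intro mult_left_mono e) auto
    finally show ?thesis by (simp add: dist_norm)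
  qed
  have "0 \<le> B" using e[of 0] norm_ge_zero order_trans by blast
  moreover have "B \<noteq> 0" using sep[of 0] by auto
  ultimately have B: "0 < B" by simp
  then obtain n where "\<And>k l. n \<le> k \<Longrightarrow> n \<le> l \<Longrightarrow> dist (g k) (g l) < 1 / B"
    using ca_lessD[OF bdd, of "1 / B"] ca by (metis le_less_trans zero_less_divide_1_iff)
  from this[of n "Suc n"] sep[of n] B show False by (simp add: field_simps)
qed

theorem theorem2p4:
  shows "(\<exists>C\<ge>0. C_Schur C TYPE('a::banach \<Rightarrow>\<^sub>L real)) \<longleftrightarrow>
         (direct_qDP TYPE('a) \<and> \<not> contains_l1 TYPE('a))"
proof
  assume "\<exists>C\<ge>0. C_Schur C TYPE('a \<Rightarrow>\<^sub>L real)"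
  then show "direct_qDP TYPE('a) \<and> \<not> contains_l1 TYPE('a)"
    using C_Schur_imp_direct_qDP contains_l1_imp_not_C_Schur by blast
next
  assume *: "direct_qDP TYPE('a) \<and> \<not> contains_l1 TYPE('a)"
  then obtain K where K: "0 < K"
    "\<And>x :: nat \<Rightarrow> ('a \<Rightarrow>\<^sub>L real). bounded (range x) \<Longrightarrow> ca_rho x \<le> K * qdelta x"
    unfolding direct_qDP_def by blast
  have "C_Schur (2 * K + 1) TYPE('a \<Rightarrow>\<^sub>L real)"
    using K * by (intro direct_qDP_imp_C_Schur) auto
  then show "\<exists>C\<ge>0. C_Schur C TYPE('a \<Rightarrow>\<^sub>L real)"
    using K(1) by (intro exI[of _ "2 * K + 1"]) auto
qed

end
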